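(* Any (randomized) algorithm that, given {\textsc{COND-EVAL}} access to an unknown distribution $D$ on $[n]$, approximates the support size $|\mathrm{supp}(D)|$ within a multiplicative $(1+\epsilon)$-factor with probability at least $2/3$, must make $\Omega\!\left(\log\log\log n + \frac{1}{\epsilon^2\log(1/\epsilon)}\right)$ queries.
   Context: $[n]=\{1,\dots,n\}$. For a distribution $D$ on $[n]$ and $S\subseteq[n]$, $D(S)=\sum_{i\in S}D(i)$, and $\mathrm{supp}(D)=\{x: D(x)>0\}$. A {\textsc{COND-EVAL}} (conditional evaluation) oracle for $D$ takes as input any set $S\subseteq[n]$ (possibly chosen adaptively); if $D(S)>0$ it returns the tuple $(j,D(j),D(j)/D(S))$ where $j\in S$ is drawn with probability $D(j)/D(S)$, and if $D(S)=0$ it returns "failure". An estimate $\hat{s}$ is within a multiplicative $(1+\epsilon)$-factor if $|\mathrm{supp}(D)|/(1+\epsilon)\le\hat{s}\le(1+\epsilon)|\mathrm{supp}(D)|$. The guarantee must hold for every distribution $D$ on $[n]$.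
   Formalization: The bound is proved for n large, ε ≤ ε₀ for any fixed ε₀ < 1 (constants depend on ε₀), and 1/ε² ≤ n; without such limits it fails, since querying all n singletons finds the support exactly while 1/(ε² log(1/ε)) is unbounded as ε → 0 or ε → 1. *)

theory Defs
  imports "HOL-Probability.Probability"
begin

definition distributions :: "nat \<Rightarrow> nat pmf set" where
  "distributions n = {D. set_pmf D \<subseteq> {1..n}}"

type_synonym response = "(nat \<times> real \<times> real) option"

text \<open>The response \<open>None\<close> stands for ``failure''. For a distribution on \<open>{1..n}\<close> the response
  to \<open>S\<close> depends only on \<open>S \<inter> {1..n}\<close>, so query sets need not be restricted to subsets
  of \<open>{1..n}\<close>.\<close>

definition cond_eval :: "nat pmf \<Rightarrow> nat set \<Rightarrow> response pmf" where
  "cond_eval D S =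
    (if measure_pmf.prob D S > 0
     then map_pmf (\<lambda>j. Some (j, pmf D j, pmf D j / measure_pmf.prob D S)) (cond_pmf D S)
     else return_pmf None)"

text \<open>A deterministic adaptive algorithm is a decision tree: it either stops with an estimate, or
  queries a set and continues depending on the response.\<close>

datatype strategy = Output real | Query "nat set" "response \<Rightarrow> strategy"

text \<open>Joint distribution of the estimate and the number of queries made.\<close>

primrec run :: "nat pmf \<Rightarrow> strategy \<Rightarrow> (real \<times> nat) pmf" where
  "run D (Output s) = return_pmf (s, 0)"
| "run D (Query S k) =
    bind_pmf (cond_eval D S) (\<lambda>r. map_pmf (\<lambda>(s, m). (s, Suc m)) (run D (k r)))"

definition estimate_distr :: "nat pmf \<Rightarrow> strategy \<Rightarrow> real measure" where
  "estimate_distr D t = distr (measure_pmf (run D t)) borel fst"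

text \<open>A randomized algorithm is a probability measure on deterministic algorithms, on any
  sigma-algebra for which its output on each distribution is a well-defined random variable. The
  internal randomness is not restricted to be discrete.\<close>

definition randomized_algorithm :: "nat \<Rightarrow> strategy measure \<Rightarrow> bool" where
  "randomized_algorithm n A \<longleftrightarrow>
    prob_space A \<and> (\<forall>D\<in>distributions n. estimate_distr D \<in> measurable A (subprob_algebra borel))"

definition output_distr :: "strategy measure \<Rightarrow> nat pmf \<Rightarrow> real measure" where
  "output_distr A D = A \<bind> estimate_distr D"

definition within_factor :: "real \<Rightarrow> real \<Rightarrow> real \<Rightarrow> bool" where
  "within_factor \<epsilon> x s \<longleftrightarrow> x / (1 + \<epsilon>) \<le> s \<and> s \<le> (1 + \<epsilon>) * x"

definition approximates_support_size :: "nat \<Rightarrow> real \<Rightarrow> strategy measure \<Rightarrow> bool" where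
  "approximates_support_size n \<epsilon> A \<longleftrightarrow>
    (\<forall>D\<in>distributions n.
      measure (output_distr A D) {s. within_factor \<epsilon> (real (card (set_pmf D))) s} \<ge> 2 / 3)"

definition makes_at_most_queries :: "nat \<Rightarrow> nat \<Rightarrow> strategy measure \<Rightarrow> bool" where
  "makes_at_most_queries n q A \<longleftrightarrow>
    (\<forall>D\<in>distributions n. AE t in A. \<forall>(s, m)\<in>set_pmf (run D t). m \<le> q)"

end

theory Submission
  imports Defs "HOL-Library.Function_Algebras"
begin

text \<open>
  The hard distributions have random weights \<open>w\<^sub>1 \<gg> w\<^sub>2 \<gg> \<dots>\<close> on a support \<open>T\<close>, each uniform on a range so
  long that it hides everything a subset sum contains of the later weights. A conditional sample from \<open>S\<close>
  is then almost surely the least element of \<open>S \<inter> T\<close>, so a query amounts to two subset sums. If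
  the incidence column of an index \<open>i\<close> with the queried sets lies in the rational span of the columns of
  the indices \<open>k < i\<close> in \<open>T\<close>, then shifting the weights of the latter compensates for the presence of \<open>i\<close>,
  and the answers have nearly the same law whether or not \<open>i\<close> belongs to \<open>T\<close>. The remaining indices of \<open>T\<close> have
  linearly independent columns, so there are at most as many of them as queried sets.

  For a uniformly random \<open>T\<close> in a ground set of about \<open>1 / \<epsilon>\<^sup>2\<close> elements this leaves, after few queries,
  most membership bits fair and independent, so the support size fluctuates by more than the permitted
  error. For \<open>T = {1..s}\<close> every query helps to locate \<open>s\<close> only at a bounded number of places,
  so few queries cannot tell apart the logarithmically many sizes \<open>s = 4 ^ l\<close>.
\<close>

subsection \<open>Adaptive sum queries\<close>

text \<open>The obstacle is that the oracle reports exact probabilities: \<open>D(j)\<close> and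
  \<open>D(j)/D(S)\<close> together reveal every digit of \<open>D(S)\<close>. A small weight cannot
  be hidden by sampling noise, only by an exact compensation among random larger weights. Hence the
  weights are integers on lattices, since a compensation must again be an admissible weight vector,
  dependence is taken over the rationals, whose denominators can be cleared, and only indices below
  \<open>i\<close> may compensate for \<open>i\<close>: their ranges are wide enough to absorb
  weight \<open>i\<close>, while those of later indices are not.

  The segment argument pays a factor of about \<open>m\<close> for the \<open>m\<close>-th question,
  because \<open>m\<close> rows expose at most \<open>m\<close> indices. With
  \<open>2 * q + 1\<close> sum questions for \<open>q\<close> oracle calls, the number of
  distinguishable sizes is of order \<open>(2 * q + 3)!\<close>, so that \<open>q * ln q\<close> is
  at least of order \<open>ln (ln n)\<close>, more than the triple logarithm. Likewise the random
  supports give order \<open>1 / \<epsilon>\<^sup>2\<close> for small \<epsilon> without the factor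
  \<open>ln (1 / \<epsilon>)\<close>. The final estimates only weaken these two bounds.\<close>

datatype sum_tree = Leaf real | Ask "nat set" "nat \<Rightarrow> sum_tree"

primrec trace :: "(nat set \<Rightarrow> nat) \<Rightarrow> sum_tree \<Rightarrow> (nat set \<times> nat) list" where
  "trace F (Leaf s) = []"
| "trace F (Ask S k) = (S, F S) # trace F (k (F S))"

primrec outcome :: "(nat set \<Rightarrow> nat) \<Rightarrow> sum_tree \<Rightarrow> real" where
  "outcome F (Leaf s) = s"
| "outcome F (Ask S k) = outcome F (k (F S))"

abbreviation rows :: "(nat set \<times> nat) list \<Rightarrow> nat set set" where
  "rows \<tau> \<equiv> fst ` set \<tau>"

text \<open>Agreement is demanded only on sets occurring in one of the two traces: shifted weights
  are controlled on the rows of a given transcript and nowhere else.\<close>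

lemma take_trace_cong:
  assumes "\<And>S. S \<in> rows (take m (trace F t)) \<Longrightarrow> F' S = F S"
  shows "take m (trace F' t) = take m (trace F t)"
  using assms
proof (induction t arbitrary: m)
  case (Ask S k)
  show ?case
  proof (cases m)
    case (Suc m')
    have "F' S = F S" using Ask.prems Suc by simp
    moreover have "take m' (trace F' (k (F S))) = take m' (trace F (k (F S)))"
      using Ask.prems Suc by (intro Ask.IH) auto
    ultimately show ?thesis using Suc by simp
  qed simp
qed simp

lemma outcome_cong:
  "trace F t = trace F' t \<Longrightarrow> outcome F t = outcome F' t"
  by (induction t) auto

text \<open>A set is chosen before its answer is known. Exposure after \<open>Suc m\<close>
  questions is therefore a function of the first \<open>m\<close> answers, which is what makes a
  recursion for \<open>mass\<close> possible.\<close>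

lemma map_fst_take_Suc_trace_cong:
  "take m (trace F t) = take m (trace F' t) \<Longrightarrow>
    map fst (take (Suc m) (trace F t)) = map fst (take (Suc m) (trace F' t))"
proof (induction t arbitrary: m)
  case (Ask S k)
  then show ?case by (cases m) auto
qed simp

subsection \<open>Free and exposed indices\<close>

interpretation qv: vector_space "\<lambda>(c::rat) (f::nat set \<Rightarrow> rat). (\<lambda>S. c * f S)"
  by unfold_locales (auto simp: fun_eq_iff algebra_simps)

text \<open>Vectors are indexed by all sets and vanish off \<open>R\<close>, so that one vector
  space serves every \<open>R\<close>.\<close>

definition col :: "nat set set \<Rightarrow> nat \<Rightarrow> nat set \<Rightarrow> rat" where
  "col R k = (\<lambda>S. of_bool (S \<in> R \<and> k \<in> S))"

text \<open>Index \<open>k\<close> carries a larger weight than every index above it. A free index is one whose weight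
  can be traded, without affecting the answers to \<open>R\<close>, against larger weights of the support.\<close>

definition free :: "nat set set \<Rightarrow> nat set \<Rightarrow> nat \<Rightarrow> bool" where
  "free R T i \<longleftrightarrow> col R i \<in> qv.span (col R ` {k \<in> T. k < i})"

text \<open>Coefficients are attached to indices rather than to vectors, since distinct indices may
  have equal columns; hence the induction that splits off one index at a time.\<close>

lemma span_col_coeffs:
  assumes "finite A" "x \<in> qv.span (col R ` A)"
  shows "\<exists>c. \<forall>S. x S = (\<Sum>k\<in>A. c k * col R k S)"
  using assms
proof (induction A arbitrary: x)
  case empty
  then show ?case by (auto simp: zero_fun_def)
next
  case (insert a A)
  from insert.prems obtain u where "x - (\<lambda>S. u * col R a S) \<in> qv.span (col R ` A)"
    by (auto simp: qv.span_breakdown_eq)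
  from insert.IH[OF this] obtain c where
    c: "\<And>S. x S - u * col R a S = (\<Sum>k\<in>A. c k * col R k S)"
    by auto
  have "x S = (\<Sum>k\<in>insert a A. (c(a := u)) k * col R k S)" for S
  proof -
    have "(\<Sum>k\<in>A. (c(a := u)) k * col R k S) = (\<Sum>k\<in>A. c k * col R k S)"
      using insert.hyps by (intro sum.cong) auto
    then show ?thesis using c[of S] insert.hyps by simp
  qed
  then show ?case by blast
qed

lemma free_coeffs:
  assumes "finite T" "free R T i"
  shows "\<exists>c::nat \<Rightarrow> rat. \<forall>S\<in>R. (\<Sum>k\<in>{k \<in> T. k < i} \<inter> S. c k) = of_bool (i \<in> S)"
proof -
  obtain c where c: "\<And>S. col R i S = (\<Sum>k\<in>{k \<in> T. k < i}. c k * col R k S)"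
    using span_col_coeffs[of "{k \<in> T. k < i}"] assms unfolding free_def by fastforce
  have "(\<Sum>k\<in>{k \<in> T. k < i} \<inter> S. c k) = of_bool (i \<in> S)" if "S \<in> R" for S
  proof -
    have "(\<Sum>k\<in>{k \<in> T. k < i} \<inter> S. c k) = (\<Sum>k\<in>{k \<in> T. k < i}. c k * col R k S)"
      using assms(1) that by (intro sum.mono_neutral_cong_left) (auto simp: col_def)
    then show ?thesis using c[of S] that by (simp add: col_def)
  qed
  then show ?thesis by blast
qed

lemma free_cong: "{k \<in> T. k < i} = {k \<in> T'. k < i} \<Longrightarrow> free R T i = free R T' i"
  by (simp add: free_def)

text \<open>If \<open>i < j\<close>, the column of \<open>i\<close> already lies in the span that
  decides \<open>j\<close>, so adding it is redundant; otherwise \<open>i\<close> does not enter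
  that span. This makes the set of free indices invariant under toggling free indices.\<close>

lemma free_insert:
  assumes "free R T i"
  shows "free R (insert i T) j \<longleftrightarrow> free R T j"
proof (cases "i < j")
  case True
  have "qv.span (col R ` {k \<in> T. k < i}) \<subseteq> qv.span (col R ` {k \<in> T. k < j})"
    using True by (intro qv.span_mono image_mono) auto
  then have "col R i \<in> qv.span (col R ` {k \<in> T. k < j})"
    using assms by (auto simp: free_def)
  moreover have "{k \<in> insert i T. k < j} = insert i {k \<in> T. k < j}" using True by auto
  ultimately show ?thesis by (simp add: free_def qv.span_redundant)
next
  case False
  then show ?thesis by (intro free_cong) auto
qed

text \<open>Scanning \<open>T\<close> upwards, each exposed index contributes a column outside the
  span of all columns before it. The exposed columns are thus distinct and independent, and they
  live in the span of one unit vector per row.\<close>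

lemma card_exposed_le:
  assumes "finite T" "finite R"
  shows "card {k \<in> T. \<not> free R T k} \<le> card R"
proof -
  define P where "P m = {k \<in> T. k < m \<and> \<not> free R T k}" for m
  have "\<not> qv.dependent (col R ` P m) \<and> inj_on (col R) (P m)" for m
  proof (induction m)
    case 0
    then show ?case by (simp add: P_def qv.independent_empty)
  next
    case (Suc m)
    show ?case
    proof (cases "m \<in> T \<and> \<not> free R T m")
      case True
      have "col R ` P m \<subseteq> col R ` {k \<in> T. k < m}" by (auto simp: P_def)
      then have "qv.span (col R ` P m) \<subseteq> qv.span (col R ` {k \<in> T. k < m})"
        by (rule qv.span_mono)
      then have notin: "col R m \<notin> qv.span (col R ` P m)" using True by (auto simp: free_def)
      have eq: "P (Suc m) = insert m (P m)" using True by (auto simp: P_def less_Suc_eq)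
      have "col R m \<notin> col R ` P m" using notin qv.span_base by blast
      then show ?thesis
        using Suc notin eq by (auto simp: qv.independent_insert)
    next
      case False
      then have "P (Suc m) = P m" by (auto simp: P_def less_Suc_eq)
      then show ?thesis using Suc by simp
    qed
  qed
  note ind = this
  obtain m where "\<forall>k\<in>T. k < m" using assms(1) finite_nat_set_iff_bounded by blast
  then have P: "P m = {k \<in> T. \<not> free R T k}" by (auto simp: P_def)
  define unit where "unit S = (\<lambda>S'. of_bool (S' = S) :: rat)" for S :: "nat set"
  have "col R k \<in> qv.span (unit ` R)" for k
  proof -
    have "col R k = (\<Sum>S\<in>R. (\<lambda>S'. col R k S * unit S S'))"
    proof
      fix S'
      have "(\<Sum>S\<in>R. (\<lambda>S'. col R k S * unit S S')) S' = (\<Sum>S\<in>R. col R k S * unit S S')"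
        using assms(2) by (induction R) (auto simp: col_def)
      also have "\<dots> = (\<Sum>S\<in>R. if S = S' then col R k S' else 0)"
        by (intro sum.cong) (auto simp: unit_def)
      also have "\<dots> = col R k S'" using assms(2) by (auto simp: col_def)
      finally show "col R k S' = (\<Sum>S\<in>R. (\<lambda>S'. col R k S * unit S S')) S'" by simp
    qed
    also have "\<dots> \<in> qv.span (unit ` R)"
      by (intro qv.span_sum qv.span_scale qv.span_base) auto
    finally show ?thesis .
  qed
  then have "card (col R ` P m) \<le> card (unit ` R)"
    using ind[of m] assms(2) by (intro conjunct2[OF qv.independent_span_bound]) auto
  also have "card (unit ` R) \<le> card R" using assms(2) by (rule card_image_le)
  finally show ?thesis using ind[of m] P by (simp add: card_image)
qed

section \<open>Integral coefficients with one common multiplier\<close>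

lemma common_multiplier:
  assumes "finite (C :: rat set)"
  shows "\<exists>K::nat. K > 0 \<and> (\<forall>r\<in>C. \<exists>e::int. of_int e = of_nat K * r \<and> \<bar>e\<bar> \<le> int (K * K))"
proof -
  have "\<exists>K::nat. K > 0 \<and> (\<forall>r\<in>C. \<bar>r\<bar> \<le> of_nat K \<and> of_nat K * r \<in> \<int>)"
    using assms
  proof (induction C)
    case empty
    show ?case by auto
  next
    case (insert r C)
    then obtain K :: nat where K: "K > 0" "\<And>s. s \<in> C \<Longrightarrow> \<bar>s\<bar> \<le> of_nat K" 
      "\<And>s. s \<in> C \<Longrightarrow> of_nat K * s \<in> \<int>" by blast
    obtain a b :: int where ab: "r = of_int a / of_int b" "b > 0"
      by (metis quotient_of_div quotient_of_denom_pos surj_pair)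
    \<comment> \<open>The factor \<open>|a| + 1\<close> makes \<open>M\<close> bound
      \<open>|r|\<close> as well, so that a single number both clears denominators and bounds
      sizes.\<close>
    define M where "M = nat b * (nat \<bar>a\<bar> + 1)"
    have M: "M > 0" using ab by (simp add: M_def)
    have Mr: "of_nat M * r \<in> \<int>"
    proof -
      have "of_nat M * r = of_int (a * (\<bar>a\<bar> + 1))" using ab by (simp add: M_def field_simps)
      then show ?thesis by (metis Ints_of_int)
    qed
    have rM: "\<bar>r\<bar> \<le> of_nat M"
    proof -
      have "\<bar>r\<bar> \<le> of_int \<bar>a\<bar>" using ab divide_left_mono[of 1 "rat_of_int b" "\<bar>rat_of_int a\<bar>"] by (simp add: abs_divide)
      also have "\<dots> \<le> of_int (b * (\<bar>a\<bar> + 1))"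
        using ab(2) by (smt (verit) mult_le_cancel_right1 of_int_le_iff)
      also have "\<dots> = of_nat M" using ab by (simp add: M_def algebra_simps)
      finally show ?thesis .
    qed
    have "\<bar>s\<bar> \<le> of_nat (K * M) \<and> of_nat (K * M) * s \<in> \<int>" if "s \<in> insert r C" for s
    proof (cases "s = r")
      case True
      have "(of_nat M::rat) \<le> of_nat (K * M)" using K(1) by (subst of_nat_le_iff) auto
      moreover have "of_nat (K * M) * s = of_nat K * (of_nat M * r)" using True by simp
      ultimately show ?thesis using rM Mr True by (metis Ints_mult Ints_of_nat order_trans)
    next
      case False
      then have s: "s \<in> C" using that by simp
      have "(of_nat K::rat) \<le> of_nat (K * M)" using M by (subst of_nat_le_iff) auto
      moreover have "of_nat (K * M) * s = of_nat M * (of_nat K * s)" by simp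
      ultimately show ?thesis using K(2,3)[OF s] by (metis Ints_mult Ints_of_nat order_trans)
    qed
    then show ?case using K(1) M by (intro exI[of _ "K * M"]) auto
  qed
  then obtain K :: nat where K: "K > 0" "\<And>r. r \<in> C \<Longrightarrow> \<bar>r\<bar> \<le> of_nat K"
    "\<And>r. r \<in> C \<Longrightarrow> of_nat K * r \<in> \<int>" by blast
  have "\<exists>e::int. of_int e = of_nat K * r \<and> \<bar>e\<bar> \<le> int (K * K)" if r: "r \<in> C" for r
  proof -
    obtain e where e: "of_nat K * r = of_int e" using K(3)[OF r] by (auto elim: Ints_cases)
    have "\<bar>of_nat K * r\<bar> \<le> of_nat K * of_nat K"
      using K(2)[OF r] by (simp add: abs_mult mult_left_mono)
    then have "of_int \<bar>e\<bar> \<le> (of_int (int (K * K)) :: rat)" using e by simp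
    then show ?thesis using e by (metis of_int_le_iff)
  qed
  then show ?thesis using K(1) by blast
qed

text \<open>One \<open>K\<close> must serve all transcripts, whose query sets range over an infinite
  family. Only the intersections with \<open>{1..N}\<close> matter, which leaves finitely many
  linear systems; \<open>K\<close> clears the denominators of one chosen solution of each. The bound
  \<open>K * K\<close> arises from scaling coefficients of size at most \<open>K\<close> by
  \<open>K\<close>.\<close>

lemma free_int_coeffs:
  "\<exists>K::nat. K > 0 \<and> (\<forall>R T i. T \<subseteq> {1..N} \<longrightarrow> i \<in> {1..N} \<longrightarrow> free R T i \<longrightarrow>
    (\<exists>e::nat \<Rightarrow> int. (\<forall>k. \<bar>e k\<bar> \<le> int (K * K)) \<and>
      (\<forall>S\<in>R. (\<Sum>k\<in>{k \<in> T. k < i} \<inter> S. e k) = (if i \<in> S then int K else 0))))"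
proof -
  define ok :: "nat set set \<Rightarrow> nat set \<Rightarrow> nat \<Rightarrow> (nat \<Rightarrow> rat) \<Rightarrow> bool" where
    "ok R T i c \<longleftrightarrow> (\<forall>S\<in>R. (\<Sum>k\<in>{k \<in> T. k < i} \<inter> S. c k) = of_bool (i \<in> S))" for R T i c
  define sol where "sol R T i = (SOME c. ok R T i c)" for R T i
  define C where "C = (\<lambda>(R, T, i, k). sol R T i k) `
    (Pow (Pow {1..N}) \<times> Pow {1..N} \<times> {1..N} \<times> {1..N})"
  have "finite C" unfolding C_def by (intro finite_imageI finite_cartesian_product) auto
  from common_multiplier[OF this] obtain K :: nat where K: "K > 0"
    "\<And>r. r \<in> C \<Longrightarrow> \<exists>e::int. of_int e = of_nat K * r \<and> \<bar>e\<bar> \<le> int (K * K)" by blast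
  have "\<exists>e::nat \<Rightarrow> int. (\<forall>k. \<bar>e k\<bar> \<le> int (K * K)) \<and>
      (\<forall>S\<in>R. (\<Sum>k\<in>{k \<in> T. k < i} \<inter> S. e k) = (if i \<in> S then int K else 0))"
    if T: "T \<subseteq> {1..N}" and i: "i \<in> {1..N}" and fr: "free R T i" for R T i
  proof -
    define R' where "R' = (\<lambda>S. S \<inter> {1..N}) ` R"
    have fin: "finite T" using T finite_subset by blast
    have restr: "{k \<in> T. k < i} \<inter> (S \<inter> {1..N}) = {k \<in> T. k < i} \<inter> S" for S using T by auto
    obtain c where "ok R T i c" using free_coeffs[OF fin fr] by (auto simp: ok_def)
    then have "ok R' T i c" using i unfolding ok_def R'_def by (auto simp: restr simp del: One_nat_def)
    then have sol: "ok R' T i (sol R' T i)" unfolding sol_def by (rule someI[of "ok R' T i"])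
    have "sol R' T i k \<in> C" if "k \<in> {1..N}" for k
      unfolding C_def using that T i by (intro image_eqI[of _ _ "(R', T, i, k)"]) (auto simp: R'_def)
    then have "\<exists>e::int. k \<in> {1..N} \<longrightarrow> of_int e = of_nat K * sol R' T i k \<and> \<bar>e\<bar> \<le> int (K * K)" for k
      using K(2) by blast
    then obtain e' :: "nat \<Rightarrow> int" where
      e': "\<And>k. k \<in> {1..N} \<Longrightarrow> of_int (e' k) = of_nat K * sol R' T i k \<and> \<bar>e' k\<bar> \<le> int (K * K)"
      by metis
    define e where "e k = (if k \<in> {1..N} then e' k else 0)" for k
    have "(\<Sum>k\<in>{k \<in> T. k < i} \<inter> S. e k) = (if i \<in> S then int K else 0)" if S: "S \<in> R" for S
    proof -
      have "(of_int (\<Sum>k\<in>{k \<in> T. k < i} \<inter> S. e k) :: rat)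
          = (\<Sum>k\<in>{k \<in> T. k < i} \<inter> S. of_nat K * sol R' T i k)"
        unfolding of_int_sum using T e' by (intro sum.cong) (auto simp: e_def)
      also have "\<dots> = of_nat K * (\<Sum>k\<in>{k \<in> T. k < i} \<inter> (S \<inter> {1..N}). sol R' T i k)"
        by (simp add: sum_distrib_left restr del: One_nat_def)
      also have "\<dots> = of_nat K * of_bool (i \<in> S \<inter> {1..N})"
        using sol S unfolding ok_def R'_def by auto
      also have "\<dots> = of_int (if i \<in> S then int K else 0)" using i by auto
      finally show ?thesis by (simp only: of_int_eq_iff)
    qed
    moreover have "\<bar>e k\<bar> \<le> int (K * K)" for k using e' by (auto simp: e_def)
    ultimately show ?thesis by blast
  qed
  then show ?thesis using K(1) by blast
qed

subsection \<open>Weights that mask each other\<close>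

definition wsum :: "(nat \<Rightarrow> nat) \<Rightarrow> nat set \<Rightarrow> nat set \<Rightarrow> nat" where
  "wsum \<omega> T S = (\<Sum>k\<in>S \<inter> T. \<omega> k)"

definition obs :: "sum_tree \<Rightarrow> nat \<Rightarrow> nat set \<Rightarrow> (nat \<Rightarrow> nat) \<Rightarrow> (nat set \<times> nat) list" where
  "obs t m T \<omega> = take m (trace (wsum \<omega> T) t)"

definition obs_prob ::
    "(nat \<Rightarrow> nat) set \<Rightarrow> sum_tree \<Rightarrow> nat \<Rightarrow> nat set \<Rightarrow> (nat set \<times> nat) list \<Rightarrow> real" where
  "obs_prob \<Omega> t m T \<tau> = real (card {\<omega> \<in> \<Omega>. obs t m T \<omega> = \<tau>}) / real (card \<Omega>)"

text \<open>The interface to both lower bound arguments. \<open>lead\<close> sees only the sum, so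
  an answered sum identifies the index that the oracle most likely returns. \<open>flip\<close> is
  an L1 estimate restricted to transcripts that leave \<open>i\<close> free; \<open>\<eta>\<close>
  is the common error of domination and of masking.\<close>

locale masked_weights =
  fixes N :: nat and \<eta> :: real and \<Omega> :: "(nat \<Rightarrow> nat) set" and lead :: "nat \<Rightarrow> nat"
  assumes finite_\<Omega>: "finite \<Omega>" and \<Omega>_nonempty: "\<Omega> \<noteq> {}"
    and weight_pos: "\<lbrakk>\<omega> \<in> \<Omega>; k \<in> {1..N}\<rbrakk> \<Longrightarrow> \<omega> k > 0"
    and lead_in: "\<lbrakk>\<omega> \<in> \<Omega>; T \<subseteq> {1..N}; wsum \<omega> T S > 0\<rbrakk> \<Longrightarrow> lead (wsum \<omega> T S) \<in> S \<inter> T"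
    and lead_dominates: "\<lbrakk>\<omega> \<in> \<Omega>; T \<subseteq> {1..N}; wsum \<omega> T S > 0\<rbrakk> \<Longrightarrow>
      (1 - \<eta>) * real (wsum \<omega> T S) \<le> real (\<omega> (lead (wsum \<omega> T S)))"
    and flip: "\<lbrakk>T \<subseteq> {1..N}; i \<in> {1..N}; i \<notin> T; finite \<Theta>\<rbrakk> \<Longrightarrow>
      (\<Sum>\<tau> | \<tau> \<in> \<Theta> \<and> free (rows \<tau>) T i.
        \<bar>obs_prob \<Omega> t m T \<tau> - obs_prob \<Omega> t m (insert i T) \<tau>\<bar>) \<le> \<eta>"

text \<open>Weight \<open>k\<close> ranges over multiples of \<open>K ^ k\<close> in a range of length \<open>K ^ k * X k\<close>. Since the
  coefficients expressing a free column have denominators dividing \<open>K\<close>, a change of weight \<open>i\<close>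
  can be undone in all row sums by moving the weights \<open>k < i\<close> along their lattices, and since
  \<open>X k\<close> exceeds \<open>X i\<close> by a factor of at least \<open>B\<close>, this rarely leaves their ranges.\<close>

locale weight_scale =
  fixes N K B :: nat
  assumes K_pos: "K > 0" and B_pos: "B > 0"
    and coeffs: "\<lbrakk>T \<subseteq> {1..N}; i \<in> {1..N}; free R T i\<rbrakk> \<Longrightarrow>
    \<exists>e::nat \<Rightarrow> int. (\<forall>k. \<bar>e k\<bar> \<le> int (K * K)) \<and>
      (\<forall>S\<in>R. (\<Sum>k\<in>{k \<in> T. k < i} \<inter> S. e k) = (if i \<in> S then int K else 0))"
begin

definition X :: "nat \<Rightarrow> nat" where "X k = B ^ (N + 1 - k)"
text \<open>Compensating for weight \<open>i > k\<close> changes the multiplier of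
  \<open>K ^ k\<close> in weight \<open>k\<close> by at most
  \<open>K ^ 2 * K ^ (i - 1 - k) * 2 * X i\<close>, and \<open>X i \<le> B ^ (N - k)\<close>; the
  margin dominates this for all \<open>i\<close> at once.\<close>

definition margin :: "nat \<Rightarrow> nat" where "margin k = 2 * K ^ (N + 1) * B ^ (N - k)"
definition lev :: "nat \<Rightarrow> nat set" where "lev k = (\<lambda>x. K ^ k * x) ` {X k..<2 * X k}"
definition bad :: "nat \<Rightarrow> nat set" where
  "bad k = (\<lambda>x. K ^ k * x) ` {x \<in> {X k..<2 * X k}. x < X k + margin k \<or> 2 * X k < x + margin k + 1}"
definition \<Omega> :: "(nat \<Rightarrow> nat) set" where "\<Omega> = PiE {1..N} lev"
definition boundary :: "(nat \<Rightarrow> nat) set" where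
  "boundary = {\<omega> \<in> \<Omega>. \<exists>k\<in>{1..N}. \<omega> k \<in> bad k}"

lemma X_pos: "X k > 0" using B_pos by (simp add: X_def)

lemma card_lev: "card (lev k) = X k"
  unfolding lev_def using K_pos by (subst card_image) (auto simp: inj_on_def)

lemma card_bad: "card (bad k) \<le> 2 * margin k"
proof -
  have "{x \<in> {X k..<2 * X k}. x < X k + margin k \<or> 2 * X k < x + margin k + 1}
      \<subseteq> {X k..<X k + margin k} \<union> {2 * X k - margin k..<2 * X k}" by auto
  then have "card {x \<in> {X k..<2 * X k}. x < X k + margin k \<or> 2 * X k < x + margin k + 1}
      \<le> card ({X k..<X k + margin k} \<union> {2 * X k - margin k..<2 * X k})"
    by (intro card_mono) auto
  also have "\<dots> \<le> card {X k..<X k + margin k} + card {2 * X k - margin k..<2 * X k}"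
    by (rule card_Un_le)
  also have "\<dots> \<le> 2 * margin k" by simp
  finally show ?thesis
    unfolding bad_def by (intro order_trans[OF card_image_le]) auto
qed

lemma finite_\<Omega>: "finite \<Omega>"
  unfolding \<Omega>_def lev_def by (intro finite_PiE) auto

lemma \<Omega>_E:
  assumes "\<omega> \<in> \<Omega>" "k \<in> {1..N}"
  obtains x where "\<omega> k = K ^ k * x" "x \<in> {X k..<2 * X k}"
proof -
  have "\<omega> k \<in> lev k" using assms by (auto simp: \<Omega>_def)
  then show ?thesis using that unfolding lev_def by blast
qed

lemma \<Omega>_nonempty: "\<Omega> \<noteq> {}"
proof -
  have "lev k \<noteq> {}" for k using card_lev[of k] X_pos[of k] by auto
  then show ?thesis by (simp add: \<Omega>_def PiE_eq_empty_iff)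
qed

text \<open>A union bound over coordinates: at most \<open>2 * margin k\<close> of the
  \<open>X k\<close> values of weight \<open>k\<close> are bad, a fraction of at most
  \<open>4 * K ^ (N + 1) / B\<close> whatever \<open>k\<close> is.\<close>

lemma card_boundary: "real (card boundary) \<le> real (4 * N * K ^ (N + 1)) / real B * real (card \<Omega>)"
proof -
  have slice: "real (card {\<omega> \<in> \<Omega>. \<omega> k \<in> bad k}) \<le> real (4 * K ^ (N + 1)) / real B * real (card \<Omega>)"
    if k: "k \<in> {1..N}" for k
  proof -
    have "{\<omega> \<in> \<Omega>. \<omega> k \<in> bad k} \<subseteq> PiE {1..N} (lev(k := bad k))"
      unfolding \<Omega>_def by (auto simp: PiE_iff extensional_def)
    then have "card {\<omega> \<in> \<Omega>. \<omega> k \<in> bad k} \<le> card (PiE {1..N} (lev(k := bad k)))"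
      by (intro card_mono finite_PiE) (auto simp: lev_def bad_def)
    also have "\<dots> = card (bad k) * (\<Prod>j\<in>{1..N} - {k}. card (lev j))"
      using k by (subst card_PiE, simp, subst prod.remove[of _ k]) (auto intro!: prod.cong)
    finally have le: "card {\<omega> \<in> \<Omega>. \<omega> k \<in> bad k} \<le> 2 * margin k * (\<Prod>j\<in>{1..N} - {k}. card (lev j))"
      using card_bad[of k] by (meson le_trans mult_le_mono1)
    have eq: "card \<Omega> = X k * (\<Prod>j\<in>{1..N} - {k}. card (lev j))"
      unfolding \<Omega>_def using k by (subst card_PiE, simp, subst prod.remove[of _ k]) (auto simp: card_lev)
    have "X k = B * B ^ (N - k)" using k by (simp add: X_def Suc_diff_le)
    then have margin: "2 * real (margin k) = real (4 * K ^ (N + 1)) / real B * real (X k)"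
      using B_pos by (simp add: margin_def)
    have "real (card {\<omega> \<in> \<Omega>. \<omega> k \<in> bad k})
        \<le> real (2 * margin k * (\<Prod>j\<in>{1..N} - {k}. card (lev j)))"
      using le by (simp only: of_nat_le_iff)
    also have "\<dots> = 2 * real (margin k) * real (\<Prod>j\<in>{1..N} - {k}. card (lev j))"
      by (simp only: of_nat_mult of_nat_numeral)
    also have "\<dots> = real (4 * K ^ (N + 1)) / real B * real (card \<Omega>)"
      unfolding margin eq of_nat_mult by (rule mult.assoc)
    finally show ?thesis .
  qed
  have "boundary = (\<Union>k\<in>{1..N}. {\<omega> \<in> \<Omega>. \<omega> k \<in> bad k})" by (auto simp: boundary_def)
  then have "card boundary \<le> (\<Sum>k\<in>{1..N}. card {\<omega> \<in> \<Omega>. \<omega> k \<in> bad k})"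
    by (simp add: card_UN_le)
  then have "real (card boundary) \<le> (\<Sum>k\<in>{1..N}. real (card {\<omega> \<in> \<Omega>. \<omega> k \<in> bad k}))"
    by (simp only: of_nat_sum[symmetric] of_nat_le_iff)
  also have "\<dots> \<le> (\<Sum>k\<in>{1..N}. real (4 * K ^ (N + 1)) / real B * real (card \<Omega>))"
    by (intro sum_mono slice)
  also have "\<dots> = real (4 * N * K ^ (N + 1)) / real B * real (card \<Omega>)" by simp
  finally show ?thesis .
qed

text \<open>Index \<open>i\<close> keeps its weight. With \<sigma> = 1 the weights of indices below
  \<open>i\<close> imitate the presence of \<open>i\<close> in the queried sums, with \<sigma> = -1
  they cancel it. Away from the boundary \<open>nat\<close> never truncates.\<close>

definition shift :: "int \<Rightarrow> (nat \<Rightarrow> int) \<Rightarrow> nat set \<Rightarrow> nat \<Rightarrow> (nat \<Rightarrow> nat) \<Rightarrow> nat \<Rightarrow> nat" where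
  "shift \<sigma> e T i \<omega> k =
    (if k \<in> T \<and> k < i then nat (int (\<omega> k) + \<sigma> * (e k * int (\<omega> i div K))) else \<omega> k)"

text \<open>Since \<open>k < i\<close>, the quotient \<open>\<omega> i div K\<close> is a multiple
  of \<open>K ^ k\<close>, so weight \<open>k\<close> stays on its lattice; off the boundary it also
  stays in its range, because the displacement is within the margin.\<close>

lemma shift_props:
  assumes T: "T \<subseteq> {1..N}" and i: "i \<in> {1..N}" and e: "\<And>k. \<bar>e k\<bar> \<le> int (K * K)"
    and \<sigma>: "\<sigma> = 1 \<or> \<sigma> = -1" and \<omega>: "\<omega> \<in> \<Omega> - boundary"
  shows "shift \<sigma> e T i \<omega> \<in> \<Omega>"
    and "\<lbrakk>k \<in> T; k < i\<rbrakk> \<Longrightarrow> int (shift \<sigma> e T i \<omega> k) = int (\<omega> k) + \<sigma> * (e k * int (\<omega> i div K))"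
proof -
  have main: "shift \<sigma> e T i \<omega> k \<in> lev k \<and>
      int (shift \<sigma> e T i \<omega> k) = int (\<omega> k) + \<sigma> * (e k * int (\<omega> i div K))"
    if k: "k \<in> T" "k < i" for k
  proof -
    have kN: "k \<in> {1..N}" using k T by auto
    obtain y where y: "\<omega> k = K ^ k * y" "y \<in> {X k..<2 * X k}"
      using \<Omega>_E \<omega> kN by blast
    obtain x where x: "\<omega> i = K ^ i * x" "x \<in> {X i..<2 * X i}"
      using \<Omega>_E \<omega> i by blast
    have "\<omega> k \<notin> bad k" using \<omega> kN by (auto simp: boundary_def)
    then have mar: "X k + margin k \<le> y" "y + margin k + 1 \<le> 2 * X k"
      using y by (auto simp: bad_def)
    have Ki: "K ^ i = K * (K ^ k * K ^ (i - 1 - k))"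
    proof -
      have "i = Suc (k + (i - 1 - k))" using k(2) by simp
      then show ?thesis by (metis power_Suc power_add)
    qed
    then have div: "\<omega> i div K = K ^ k * (K ^ (i - 1 - k) * x)"
      using x K_pos by simp
    define s where "s = \<sigma> * (e k * int (K ^ (i - 1 - k) * x))"
    have eq: "int (\<omega> k) + \<sigma> * (e k * int (\<omega> i div K)) = int (K ^ k) * (int y + s)"
      by (simp add: div y(1) s_def algebra_simps)
    have "X i \<le> B ^ (N - k)" unfolding X_def using B_pos k(2) i by (intro power_increasing) auto
    then have xle: "x \<le> 2 * B ^ (N - k)" using x by simp
    have "\<bar>s\<bar> = \<bar>e k\<bar> * int (K ^ (i - 1 - k) * x)" using \<sigma> by (auto simp: s_def abs_mult)
    also have "\<dots> \<le> int (K * K) * int (K ^ (i - 1 - k) * x)"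
      by (intro mult_right_mono e) auto
    also have "\<dots> = int (K * K * K ^ (i - 1 - k) * x)" by simp
    also have "\<dots> \<le> int (margin k)"
    proof -
      have "K * K * K ^ (i - 1 - k) = K ^ (2 + (i - 1 - k))" by (simp add: power_add power2_eq_square)
      also have "\<dots> \<le> K ^ (N + 1)" using K_pos i k(2) kN by (intro power_increasing) auto
      finally have "K * K * K ^ (i - 1 - k) * x \<le> K ^ (N + 1) * (2 * B ^ (N - k))"
        using xle by (intro mult_le_mono)
      then show ?thesis unfolding margin_def by (simp only: of_nat_le_iff mult_ac)
    qed
    finally have s: "\<bar>s\<bar> \<le> int (margin k)" .
    have z: "int (X k) \<le> int y + s" "int y + s < int (2 * X k)" using mar s by auto
    then have "shift \<sigma> e T i \<omega> k = K ^ k * nat (int y + s)"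
      using k by (simp add: shift_def eq nat_mult_distrib nat_power_eq)
    moreover have "nat (int y + s) \<in> {X k..<2 * X k}" using z by auto
    moreover have "int (shift \<sigma> e T i \<omega> k) = int (\<omega> k) + \<sigma> * (e k * int (\<omega> i div K))"
      using k z by (simp add: shift_def eq)
    ultimately show ?thesis by (auto simp: lev_def)
  qed
  show "\<lbrakk>k \<in> T; k < i\<rbrakk> \<Longrightarrow> int (shift \<sigma> e T i \<omega> k) = int (\<omega> k) + \<sigma> * (e k * int (\<omega> i div K))"
    using main by blast
  have "shift \<sigma> e T i \<omega> k \<in> lev k" if "k \<in> {1..N}" for k
  proof (cases "k \<in> T \<and> k < i")
    case False
    then show ?thesis using \<omega> that by (auto simp: shift_def \<Omega>_def PiE_iff)
  qed (use main in blast)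
  moreover have "shift \<sigma> e T i \<omega> k = undefined" if "k \<notin> {1..N}" for k
    using that T \<omega> by (auto simp: shift_def \<Omega>_def PiE_iff extensional_def)
  ultimately show "shift \<sigma> e T i \<omega> \<in> \<Omega>" by (auto simp: \<Omega>_def PiE_iff extensional_def)
qed

text \<open>The shift does not move \<open>\<omega> i\<close>, so all displacements can be read off
  the image and undone.\<close>

lemma inj_on_shift:
  assumes T: "T \<subseteq> {1..N}" and i: "i \<in> {1..N}" and e: "\<And>k. \<bar>e k\<bar> \<le> int (K * K)"
    and \<sigma>: "\<sigma> = 1 \<or> \<sigma> = -1"
  shows "inj_on (shift \<sigma> e T i) (\<Omega> - boundary)"
proof (rule inj_onI)
  fix \<omega> \<omega>' assume \<omega>: "\<omega> \<in> \<Omega> - boundary" "\<omega>' \<in> \<Omega> - boundary"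
    and eq: "shift \<sigma> e T i \<omega> = shift \<sigma> e T i \<omega>'"
  have i_eq: "\<omega> i = \<omega>' i" using fun_cong[OF eq, of i] by (simp add: shift_def)
  show "\<omega> = \<omega>'"
  proof
    fix k
    show "\<omega> k = \<omega>' k"
    proof (cases "k \<in> T \<and> k < i")
      case True
      then show ?thesis
        using shift_props(2)[where e = e, OF T i e \<sigma> \<omega>(1), of k] shift_props(2)[where e = e, OF T i e \<sigma> \<omega>(2), of k] eq i_eq
        by simp
    next
      case False
      then show ?thesis using fun_cong[OF eq, of k] by (auto simp: shift_def)
    qed
  qed
qed

lemma wsum_shift:
  assumes T: "T \<subseteq> {1..N}" and i: "i \<in> {1..N}" and e: "\<And>k. \<bar>e k\<bar> \<le> int (K * K)"
    and \<sigma>: "\<sigma> = 1 \<or> \<sigma> = -1" and \<omega>: "\<omega> \<in> \<Omega> - boundary"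
    and S: "(\<Sum>k\<in>{k \<in> T. k < i} \<inter> S. e k) = (if i \<in> S then int K else 0)"
  shows "int (wsum (shift \<sigma> e T i \<omega>) T S) = int (wsum \<omega> T S) + \<sigma> * (if i \<in> S then int (\<omega> i) else 0)"
proof -
  let ?A = "{k \<in> T. k < i} \<inter> S"
  have fin: "finite T" using T finite_subset by blast
  have "K dvd \<omega> i"
  proof -
    obtain x where "\<omega> i = K ^ i * x" using \<Omega>_E \<omega> i by blast
    moreover have "K dvd K ^ i" using i by (auto intro: dvd_power)
    ultimately show ?thesis by simp
  qed
  then have Ki: "int K * int (\<omega> i div K) = int (\<omega> i)"
    by (metis dvd_mult_div_cancel of_nat_mult)
  have "int (wsum (shift \<sigma> e T i \<omega>) T S) = (\<Sum>k\<in>S \<inter> T. int (\<omega> k) +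
      (if k < i then \<sigma> * (e k * int (\<omega> i div K)) else 0))"
    unfolding wsum_def of_nat_sum
    using shift_props(2)[where e = e, OF T i e \<sigma> \<omega>] by (intro sum.cong) (auto simp: shift_def)
  also have "\<dots> = int (wsum \<omega> T S) + (\<Sum>k\<in>S \<inter> T. if k < i then \<sigma> * (e k * int (\<omega> i div K)) else 0)"
    by (simp add: wsum_def sum.distrib)
  also have "(\<Sum>k\<in>S \<inter> T. if k < i then \<sigma> * (e k * int (\<omega> i div K)) else 0)
      = (\<Sum>k\<in>?A. \<sigma> * (e k * int (\<omega> i div K)))"
    using fin by (intro sum.mono_neutral_cong_right) auto
  also have "\<dots> = \<sigma> * (sum e ?A * int (\<omega> i div K))"
    by (simp add: sum_distrib_left sum_distrib_right)
  also have "\<dots> = \<sigma> * (if i \<in> S then int (\<omega> i) else 0)" using S Ki by simp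
  finally show ?thesis .
qed

lemma wsum_insert:
  assumes "finite T" "i \<notin> T"
  shows "wsum \<omega> (insert i T) S = wsum \<omega> T S + (if i \<in> S then \<omega> i else 0)"
proof (cases "i \<in> S")
  case True
  then have "S \<inter> insert i T = insert i (S \<inter> T)" by auto
  then show ?thesis using assms True by (simp add: wsum_def)
next
  case False
  then have "S \<inter> insert i T = S \<inter> T" by auto
  then show ?thesis using False by (simp add: wsum_def)
qed

text \<open>Off the boundary, the shift injects the weights producing \<open>\<tau>\<close> for one
  support into those producing it for the other. Boundary weights are counted separately for each
  transcript, so that the losses can be summed afterwards.\<close>

lemma card_obs_flip:
  assumes T: "T \<subseteq> {1..N}" and i: "i \<in> {1..N}" and iT: "i \<notin> T" and fr: "free (rows \<tau>) T i"
  shows "card {\<omega> \<in> \<Omega>. obs t m (insert i T) \<omega> = \<tau>} \<le>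
      card {\<omega> \<in> \<Omega>. obs t m T \<omega> = \<tau>} + card {\<omega> \<in> boundary. obs t m (insert i T) \<omega> = \<tau>}"
    and "card {\<omega> \<in> \<Omega>. obs t m T \<omega> = \<tau>} \<le>
      card {\<omega> \<in> \<Omega>. obs t m (insert i T) \<omega> = \<tau>} + card {\<omega> \<in> boundary. obs t m T \<omega> = \<tau>}"
proof -
  have fin: "finite T" using T finite_subset by blast
  obtain e where e: "\<And>k. \<bar>e k\<bar> \<le> int (K * K)" and
    S: "\<And>S. S \<in> rows \<tau> \<Longrightarrow> (\<Sum>k\<in>{k \<in> T. k < i} \<inter> S. e k) = (if i \<in> S then int K else 0)"
    using coeffs[OF T i fr] by blast
  have shift_i: "shift \<sigma> e T i \<omega> i = \<omega> i" for \<sigma> \<omega> by (simp add: shift_def)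
  have gen: "card {\<omega> \<in> \<Omega>. obs t m T1 \<omega> = \<tau>} \<le>
      card {\<omega> \<in> \<Omega>. obs t m T2 \<omega> = \<tau>} + card {\<omega> \<in> boundary. obs t m T1 \<omega> = \<tau>}"
    if \<sigma>: "\<sigma> = 1 \<or> \<sigma> = -1" and agree: "\<And>\<omega> S. \<omega> \<in> \<Omega> - boundary \<Longrightarrow> S \<in> rows \<tau> \<Longrightarrow>
      wsum (shift \<sigma> e T i \<omega>) T2 S = wsum \<omega> T1 S" for T1 T2 \<sigma>
  proof -
    have "obs t m T2 (shift \<sigma> e T i \<omega>) = \<tau>" if "\<omega> \<in> \<Omega> - boundary" "obs t m T1 \<omega> = \<tau>" for \<omega>
      using that agree take_trace_cong[of m "wsum \<omega> T1" t "wsum (shift \<sigma> e T i \<omega>) T2"]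
      by (auto simp: obs_def)
    then have "shift \<sigma> e T i ` {\<omega> \<in> \<Omega> - boundary. obs t m T1 \<omega> = \<tau>} \<subseteq> {\<omega> \<in> \<Omega>. obs t m T2 \<omega> = \<tau>}"
      using shift_props(1)[where e = e, OF T i e \<sigma>] by auto
    moreover have "inj_on (shift \<sigma> e T i) {\<omega> \<in> \<Omega> - boundary. obs t m T1 \<omega> = \<tau>}"
      by (rule inj_on_subset[OF inj_on_shift[where e = e, OF T i e \<sigma>]]) auto
    ultimately have "card {\<omega> \<in> \<Omega> - boundary. obs t m T1 \<omega> = \<tau>} \<le> card {\<omega> \<in> \<Omega>. obs t m T2 \<omega> = \<tau>}"
      using finite_\<Omega> by (intro card_inj_on_le) auto
    moreover have "{\<omega> \<in> \<Omega>. obs t m T1 \<omega> = \<tau>} \<subseteq>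
        {\<omega> \<in> \<Omega> - boundary. obs t m T1 \<omega> = \<tau>} \<union> {\<omega> \<in> boundary. obs t m T1 \<omega> = \<tau>}" by auto
    moreover have "finite boundary" using finite_\<Omega> by (auto simp: boundary_def)
    ultimately show ?thesis
      using card_mono[of "{\<omega> \<in> \<Omega> - boundary. obs t m T1 \<omega> = \<tau>} \<union> {\<omega> \<in> boundary. obs t m T1 \<omega> = \<tau>}"
          "{\<omega> \<in> \<Omega>. obs t m T1 \<omega> = \<tau>}"] finite_\<Omega>
        card_Un_le[of "{\<omega> \<in> \<Omega> - boundary. obs t m T1 \<omega> = \<tau>}" "{\<omega> \<in> boundary. obs t m T1 \<omega> = \<tau>}"]
      by simp
  qed
  show "card {\<omega> \<in> \<Omega>. obs t m (insert i T) \<omega> = \<tau>} \<le>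
      card {\<omega> \<in> \<Omega>. obs t m T \<omega> = \<tau>} + card {\<omega> \<in> boundary. obs t m (insert i T) \<omega> = \<tau>}"
  proof (rule gen[of 1])
    fix \<omega> S assume "\<omega> \<in> \<Omega> - boundary" "S \<in> rows \<tau>"
    from wsum_shift[where e = e, OF T i e _ this(1) S[OF this(2)], of 1]
    show "wsum (shift 1 e T i \<omega>) T S = wsum \<omega> (insert i T) S"
      by (auto simp: wsum_insert[OF fin iT] split: if_splits)
  qed simp
  show "card {\<omega> \<in> \<Omega>. obs t m T \<omega> = \<tau>} \<le>
      card {\<omega> \<in> \<Omega>. obs t m (insert i T) \<omega> = \<tau>} + card {\<omega> \<in> boundary. obs t m T \<omega> = \<tau>}"
  proof (rule gen[of "-1"])
    fix \<omega> S assume "\<omega> \<in> \<Omega> - boundary" "S \<in> rows \<tau>"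
    from wsum_shift[where e = e, OF T i e _ this(1) S[OF this(2)], of "-1"]
    show "wsum (shift (-1) e T i \<omega>) (insert i T) S = wsum \<omega> T S"
      by (auto simp: wsum_insert[OF fin iT] shift_i split: if_splits)
  qed simp
qed

text \<open>A boundary weight vector produces one transcript per support. Summed over transcripts
  the losses are at most \<open>card boundary\<close> for \<open>T\<close> and again for
  \<open>insert i T\<close>.\<close>

lemma obs_prob_flip:
  assumes T: "T \<subseteq> {1..N}" and i: "i \<in> {1..N}" and iT: "i \<notin> T" and fin: "finite \<Theta>"
  shows "(\<Sum>\<tau> | \<tau> \<in> \<Theta> \<and> free (rows \<tau>) T i.
      \<bar>obs_prob \<Omega> t m T \<tau> - obs_prob \<Omega> t m (insert i T) \<tau>\<bar>) \<le> real (8 * N * K ^ (N + 1)) / real B"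
proof -
  let ?\<Theta> = "{\<tau>. \<tau> \<in> \<Theta> \<and> free (rows \<tau>) T i}"
  let ?b = "\<lambda>T \<tau>. card {\<omega> \<in> boundary. obs t m T \<omega> = \<tau>}"
  have fin\<Theta>: "finite ?\<Theta>" using fin by auto
  have finb: "finite boundary" using finite_\<Omega> by (auto simp: boundary_def)
  have pos: "real (card \<Omega>) > 0" using finite_\<Omega> \<Omega>_nonempty by (simp add: card_gt_0_iff)
  have sumb: "(\<Sum>\<tau>\<in>?\<Theta>. ?b T' \<tau>) \<le> card boundary" for T'
  proof -
    have "(\<Sum>\<tau>\<in>?\<Theta>. ?b T' \<tau>) = card (\<Union>\<tau>\<in>?\<Theta>. {\<omega> \<in> boundary. obs t m T' \<omega> = \<tau>})"
      using fin\<Theta> finb by (subst card_UN_disjoint) auto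
    also have "\<dots> \<le> card boundary" using finb by (intro card_mono) auto
    finally show ?thesis .
  qed
  have "\<bar>obs_prob \<Omega> t m T \<tau> - obs_prob \<Omega> t m (insert i T) \<tau>\<bar>
      \<le> real (?b T \<tau> + ?b (insert i T) \<tau>) / real (card \<Omega>)" if "\<tau> \<in> ?\<Theta>" for \<tau>
    unfolding obs_prob_def diff_divide_distrib[symmetric] abs_divide
    using card_obs_flip[OF T i iT, of \<tau> t m] that by (auto intro!: divide_right_mono)
  then have "(\<Sum>\<tau>\<in>?\<Theta>. \<bar>obs_prob \<Omega> t m T \<tau> - obs_prob \<Omega> t m (insert i T) \<tau>\<bar>)
      \<le> (\<Sum>\<tau>\<in>?\<Theta>. real (?b T \<tau> + ?b (insert i T) \<tau>) / real (card \<Omega>))"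
    by (rule sum_mono)
  also have "\<dots> = real ((\<Sum>\<tau>\<in>?\<Theta>. ?b T \<tau>) + (\<Sum>\<tau>\<in>?\<Theta>. ?b (insert i T) \<tau>)) / real (card \<Omega>)"
    by (simp add: sum.distrib sum_divide_distrib add_divide_distrib)
  also have "\<dots> \<le> real (2 * card boundary) / real (card \<Omega>)"
    using sumb[of T] sumb[of "insert i T"] by (intro divide_right_mono) (auto simp flip: of_nat_add)
  also have "\<dots> \<le> real (8 * N * K ^ (N + 1)) / real B"
  proof -
    have "real (2 * card boundary) \<le> real (8 * N * K ^ (N + 1)) / real B * real (card \<Omega>)"
      using card_boundary by simp
    then show ?thesis using pos by (subst pos_divide_le_eq) assumption+
  qed
  finally show ?thesis .
qed

text \<open>\<open>K ^ j * X j\<close> is the least value weight \<open>j\<close> can take. A sum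
  whose least index is \<open>j\<close> reaches this threshold but, once \<open>B\<close> is large,
  none of the higher thresholds of indices \<open>l < j\<close>.\<close>

definition lead :: "nat \<Rightarrow> nat" where
  "lead v = (LEAST j. 1 \<le> j \<and> K ^ j * X j \<le> v)"

lemma lead_wsum:
  assumes B: "B > 2 * N * K ^ N" and \<omega>: "\<omega> \<in> \<Omega>" and T: "T \<subseteq> {1..N}" and pos: "wsum \<omega> T S > 0"
  shows "lead (wsum \<omega> T S) \<in> S \<inter> T"
    and "real (wsum \<omega> T S) \<le> (1 + real (2 * N * K ^ N) / real B) * real (\<omega> (lead (wsum \<omega> T S)))"
proof -
  have fin: "finite (S \<inter> T)" using T finite_subset by blast
  have ne: "S \<inter> T \<noteq> {}" using pos by (auto simp: wsum_def)
  define j where "j = Min (S \<inter> T)"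
  have j: "j \<in> S \<inter> T" unfolding j_def using fin ne by (rule Min_in)
  have j_le: "j \<le> k" if "k \<in> S \<inter> T" for k unfolding j_def using fin that by (rule Min_le)
  have jN: "j \<in> {1..N}" using j T by auto
  have lev: "K ^ k * X k \<le> \<omega> k" "\<omega> k \<le> 2 * (K ^ N * X k)" if k: "k \<in> {1..N}" for k
  proof -
    obtain x where x: "\<omega> k = K ^ k * x" "x \<in> {X k..<2 * X k}"
      using \<Omega>_E \<omega> k by blast
    show "K ^ k * X k \<le> \<omega> k" using x by simp
    have "K ^ k * x \<le> K ^ N * (2 * X k)"
      using x k K_pos by (intro mult_le_mono power_increasing) auto
    then show "\<omega> k \<le> 2 * (K ^ N * X k)" using x by simp
  qed
  have X_mono: "X k \<le> X l" if "l \<le> k" for k l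
    unfolding X_def using B_pos that by (intro power_increasing) auto
  have cardle: "card A \<le> N" if "A \<subseteq> S \<inter> T" for A
    using card_mono[of "{1..N}" A] that T by auto
  have total: "wsum \<omega> T S \<le> 2 * N * K ^ N * X j"
  proof -
    have "\<omega> k \<le> 2 * (K ^ N * X j)" if "k \<in> S \<inter> T" for k
    proof -
      have "\<omega> k \<le> 2 * (K ^ N * X k)" using that T by (intro lev(2)) auto
      also have "\<dots> \<le> 2 * (K ^ N * X j)" using X_mono[OF j_le[OF that]] by simp
      finally show ?thesis .
    qed
    then have "wsum \<omega> T S \<le> card (S \<inter> T) * (2 * (K ^ N * X j))"
      unfolding wsum_def by (metis sum_bounded_above of_nat_id)
    also have "\<dots> \<le> N * (2 * (K ^ N * X j))" using cardle by (intro mult_le_mono1) auto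
    finally show ?thesis by (simp add: mult_ac)
  qed
  have "\<omega> j \<le> wsum \<omega> T S" unfolding wsum_def using fin j by (intro member_le_sum) auto
  then have jle: "K ^ j * X j \<le> wsum \<omega> T S" using lev(1)[OF jN] by simp
  have "lead (wsum \<omega> T S) = j"
    unfolding lead_def
  proof (rule Least_equality)
    show "1 \<le> j \<and> K ^ j * X j \<le> wsum \<omega> T S" using jle jN by simp
  next
    fix l assume l: "1 \<le> l \<and> K ^ l * X l \<le> wsum \<omega> T S"
    show "j \<le> l"
    proof (rule ccontr)
      assume "\<not> j \<le> l"
      then have "B * X j \<le> X l"
        unfolding X_def power_Suc[symmetric] using B_pos jN by (intro power_increasing) auto
      also have "X l \<le> K ^ l * X l" using K_pos by simp
      also have "\<dots> \<le> 2 * N * K ^ N * X j" using l total by simp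
      finally show False using B X_pos[of j] by simp
    qed
  qed
  then show "lead (wsum \<omega> T S) \<in> S \<inter> T" using j by simp
  have rest: "sum \<omega> (S \<inter> T - {j}) * B \<le> 2 * N * K ^ N * \<omega> j"
  proof -
    have "\<omega> k * B \<le> 2 * (K ^ N * X j)" if "k \<in> S \<inter> T - {j}" for k
    proof -
      have kj: "j < k" "k \<in> {1..N}" using j_le[of k] that T by (auto simp: le_less)
      have "X k * B \<le> X j"
        unfolding X_def power_Suc2[symmetric] using B_pos kj by (intro power_increasing) auto
      have "\<omega> k * B \<le> 2 * (K ^ N * X k) * B" using lev(2)[OF kj(2)] by simp
      also have "\<dots> = 2 * (K ^ N * (X k * B))" by simp
      also have "\<dots> \<le> 2 * (K ^ N * X j)" using \<open>X k * B \<le> X j\<close> by (intro mult_le_mono2)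
      finally show ?thesis .
    qed
    then have "(\<Sum>k\<in>S \<inter> T - {j}. \<omega> k * B) \<le> card (S \<inter> T - {j}) * (2 * (K ^ N * X j))"
      by (metis sum_bounded_above of_nat_id)
    also have "\<dots> \<le> N * (2 * (K ^ N * X j))" using cardle[of "S \<inter> T - {j}"] by (intro mult_le_mono1) auto
    also have "\<dots> \<le> N * (2 * (K ^ N * \<omega> j))"
    proof -
      have "1 * X j \<le> K ^ j * X j" using K_pos by (intro mult_le_mono1) simp
      then have "X j \<le> \<omega> j" using lev(1)[OF jN] by linarith
      then show ?thesis by (intro mult_le_mono2)
    qed
    finally show ?thesis by (simp add: sum_distrib_left mult_ac)
  qed
  have "real (sum \<omega> (S \<inter> T - {j})) * real B \<le> real (2 * N * K ^ N) * real (\<omega> j)"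
    using rest by (metis of_nat_le_iff of_nat_mult)
  then have "real (sum \<omega> (S \<inter> T - {j})) \<le> real (2 * N * K ^ N) / real B * real (\<omega> j)"
    using B_pos by (simp add: field_simps)
  moreover have "wsum \<omega> T S = \<omega> j + sum \<omega> (S \<inter> T - {j})"
    unfolding wsum_def using fin j by (rule sum.remove)
  ultimately show "real (wsum \<omega> T S) \<le> (1 + real (2 * N * K ^ N) / real B) * real (\<omega> (lead (wsum \<omega> T S)))"
    using \<open>lead (wsum \<omega> T S) = j\<close> by (simp add: algebra_simps)
qed

end

lemma masked_weights_exist:
  assumes \<eta>: "\<eta> > 0"
  shows "\<exists>\<Omega> lead. masked_weights N \<eta> \<Omega> lead"
proof -
  obtain K :: nat where K: "K > 0" and
    co: "\<And>R T i. \<lbrakk>T \<subseteq> {1..N}; i \<in> {1..N}; free R T i\<rbrakk> \<Longrightarrow>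
    (\<exists>e::nat \<Rightarrow> int. (\<forall>k. \<bar>e k\<bar> \<le> int (K * K)) \<and>
      (\<forall>S\<in>R. (\<Sum>k\<in>{k \<in> T. k < i} \<inter> S. e k) = (if i \<in> S then int K else 0)))"
    using free_int_coeffs[of N] by blast
  obtain B0 :: nat where B0: "real (8 * N * K ^ (N + 1)) / \<eta> < real B0" using reals_Archimedean2 by blast
  \<comment> \<open>\<open>B0\<close> pushes the flip error below \<open>\<eta>\<close>; the
    remaining summands make \<open>lead\<close> correct.\<close>
  define B where "B = B0 + 2 * N * K ^ N + 1"
  have "B > 0" by (simp add: B_def)
  have B: "B > 0" "B > 2 * N * K ^ N" "real (8 * N * K ^ (N + 1)) / real B \<le> \<eta>"
  proof -
    have "real (8 * N * K ^ (N + 1)) / \<eta> \<le> real B" 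
    proof -
      have "real B0 \<le> real B" unfolding of_nat_le_iff by (simp add: B_def)
      then show ?thesis using B0 by linarith
    qed
    then show "real (8 * N * K ^ (N + 1)) / real B \<le> \<eta>" 
      using \<eta> \<open>B > 0\<close> by (subst (asm) pos_divide_le_eq, simp, subst pos_divide_le_eq) (simp_all add: mult.commute)
  qed (auto simp: B_def)
  interpret weight_scale N K B by unfold_locales (use K B co in auto)
  have small: "real (2 * N * K ^ N) / real B \<le> \<eta>"
  proof -
    have "2 * N * K ^ N \<le> 8 * N * K ^ (N + 1)" using K by simp
    then have "real (2 * N * K ^ N) / real B \<le> real (8 * N * K ^ (N + 1)) / real B"
      by (intro divide_right_mono) (auto simp only: of_nat_le_iff of_nat_0_le_iff)
    then show ?thesis using B(3) by simp
  qed
  have "masked_weights N \<eta> \<Omega> lead"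
  proof
    show "finite \<Omega>" "\<Omega> \<noteq> {}" by (rule finite_\<Omega>, rule \<Omega>_nonempty)
  next
    fix \<omega> k assume "\<omega> \<in> \<Omega>" "k \<in> {1..N}"
    then have "\<omega> k \<in> lev k" by (auto simp: \<Omega>_def PiE_iff)
    then show "\<omega> k > 0" using X_pos[of k] K by (auto simp: lev_def)
  next
    fix \<omega> T S assume *: "\<omega> \<in> \<Omega>" "T \<subseteq> {1..N}" "wsum \<omega> T S > 0"
    show "lead (wsum \<omega> T S) \<in> S \<inter> T" by (rule lead_wsum(1)[OF B(2) *])
    have le: "real (wsum \<omega> T S) \<le> (1 + \<eta>) * real (\<omega> (lead (wsum \<omega> T S)))"
      using lead_wsum(2)[OF B(2) *] small
      by (smt (verit) mult_right_mono of_nat_0_le_iff)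
    have "(1 - \<eta>) * real (wsum \<omega> T S) \<le> real (\<omega> (lead (wsum \<omega> T S)))"
    proof (cases "\<eta> \<le> 1")
      case True
      have "(1 - \<eta>) * real (wsum \<omega> T S) \<le> (1 - \<eta>) * ((1 + \<eta>) * real (\<omega> (lead (wsum \<omega> T S))))"
        using le True by (intro mult_left_mono) auto
      also have "\<dots> = (1 - \<eta> * \<eta>) * real (\<omega> (lead (wsum \<omega> T S)))" by (simp add: algebra_simps)
      also have "\<dots> \<le> 1 * real (\<omega> (lead (wsum \<omega> T S)))" by (intro mult_right_mono) auto
      finally show ?thesis by simp
    next
      case False
      then have "(1 - \<eta>) * real (wsum \<omega> T S) \<le> 0" by (simp add: mult_nonpos_nonneg)
      then show ?thesis by (meson of_nat_0_le_iff order_trans)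
    qed
    then show "(1 - \<eta>) * real (wsum \<omega> T S) \<le> real (\<omega> (lead (wsum \<omega> T S)))" .
  next
    fix T i \<Theta> t m assume "T \<subseteq> {1..N}" "i \<in> {1..N}" "i \<notin> T" "finite (\<Theta> :: (nat set \<times> nat) list set)"
    from obs_prob_flip[OF this] B(3)
    show "(\<Sum>\<tau> | \<tau> \<in> \<Theta> \<and> free (rows \<tau>) T i.
        \<bar>obs_prob \<Omega> t m T \<tau> - obs_prob \<Omega> t m (insert i T) \<tau>\<bar>) \<le> \<eta>"
      by (meson order_trans)
  qed
  then show ?thesis by blast
qed

subsection \<open>Transcript probabilities\<close>

text \<open>The choice is harmless: a complete transcript determines the output by
  \<open>outcome_cong\<close>.\<close>

definition outcome_of :: "sum_tree \<Rightarrow> (nat set \<times> nat) list \<Rightarrow> real" where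
  "outcome_of t \<tau> = (SOME s. \<exists>F. trace F t = \<tau> \<and> s = outcome F t)"

lemma outcome_of_trace: "outcome_of t (trace F t) = outcome F t"
  unfolding outcome_of_def by (rule some_equality) (auto dest: outcome_cong)

lemma obs_prob_nonneg: "obs_prob \<Omega> t m T \<tau> \<ge> 0"
  by (simp add: obs_prob_def)

lemma length_obs: "length (obs t m T \<omega>) \<le> m"
  by (simp add: obs_def)

lemma card_rows_le: "card (rows \<tau>) \<le> length \<tau>"
  by (rule order_trans[OF card_image_le card_length]) simp

context masked_weights
begin

abbreviation "P \<equiv> obs_prob \<Omega>"

definition average :: "((nat \<Rightarrow> nat) \<Rightarrow> real) \<Rightarrow> real" where
  "average f = (\<Sum>\<omega>\<in>\<Omega>. f \<omega>) / real (card \<Omega>)"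

definition transcripts :: "sum_tree \<Rightarrow> nat \<Rightarrow> (nat set \<times> nat) list set" where
  "transcripts t m = (\<lambda>(T, \<omega>). obs t m T \<omega>) ` (Pow {1..N} \<times> \<Omega>)"

lemma card_\<Omega>_pos: "real (card \<Omega>) > 0"
  using finite_\<Omega> \<Omega>_nonempty by (simp add: card_gt_0_iff)

lemma finite_transcripts: "finite (transcripts t m)"
  unfolding transcripts_def using finite_\<Omega> by auto

lemma sum_transcripts:
  assumes "T \<subseteq> {1..N}"
  shows "(\<Sum>\<tau>\<in>transcripts t m. f \<tau> * P t m T \<tau>) = average (\<lambda>\<omega>. f (obs t m T \<omega>))"
proof -
  have "(\<Sum>\<omega>\<in>\<Omega>. f (obs t m T \<omega>))
      = (\<Sum>\<tau>\<in>transcripts t m. \<Sum>\<omega>\<in>{\<omega> \<in> \<Omega>. obs t m T \<omega> = \<tau>}. f (obs t m T \<omega>))"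
    using assms by (intro sum.group[symmetric] finite_\<Omega> finite_transcripts) (auto simp: transcripts_def)
  also have "\<dots> = (\<Sum>\<tau>\<in>transcripts t m. f \<tau> * real (card {\<omega> \<in> \<Omega>. obs t m T \<omega> = \<tau>}))"
    by (intro sum.cong) auto
  finally show ?thesis by (simp add: average_def obs_prob_def sum_divide_distrib)
qed

lemma average_const: "average (\<lambda>_. c) = c"
  using card_\<Omega>_pos by (simp add: average_def)

lemma average_cong: "(\<And>\<omega>. \<omega> \<in> \<Omega> \<Longrightarrow> f \<omega> = g \<omega>) \<Longrightarrow> average f = average g"
  unfolding average_def by (metis sum.cong)

lemma sum_transcripts_1: "T \<subseteq> {1..N} \<Longrightarrow> (\<Sum>\<tau>\<in>transcripts t m. P t m T \<tau>) = 1"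
  using sum_transcripts[of T "\<lambda>_. 1" t m] by (simp add: average_const)

end

subsection \<open>Supports that are initial segments\<close>

context masked_weights
begin

text \<open>\<open>mass t m\<close> bounds how many segment lengths can be told apart from \<open>m\<close> answers: if each
  transcript is assigned a single length, the success probabilities sum to at most \<open>mass t m\<close>.\<close>

definition peak :: "sum_tree \<Rightarrow> nat \<Rightarrow> (nat set \<times> nat) list \<Rightarrow> real" where
  "peak t m \<tau> = Max ((\<lambda>s. P t m {1..s} \<tau>) ` {1..N})"

definition mass :: "sum_tree \<Rightarrow> nat \<Rightarrow> real" where
  "mass t m = (\<Sum>\<tau>\<in>transcripts t m. peak t m \<tau>)"

lemma P_le_peak: "s \<in> {1..N} \<Longrightarrow> P t m {1..s} \<tau> \<le> peak t m \<tau>"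
  unfolding peak_def by (intro Max_ge) auto

lemma peak_nonneg:
  assumes "N \<ge> 1"
  shows "peak t m \<tau> \<ge> 0"
  using order_trans[OF obs_prob_nonneg P_le_peak[of 1]] assms by auto

lemma mass_0:
  assumes "N \<ge> 1"
  shows "mass t 0 = 1"
proof -
  have "transcripts t 0 = {[]}"
    using \<Omega>_nonempty by (auto simp: transcripts_def obs_def)
  moreover have "P t 0 {1..s} [] = 1" for s
    using card_\<Omega>_pos by (simp add: obs_prob_def obs_def)
  ultimately show ?thesis using assms by (simp add: mass_def peak_def image_constant_conv)
qed

text \<open>Freeness of \<open>Suc s\<close> depends only on smaller indices of the support, so it
  is the same relative to \<open>{1..s}\<close> and to \<open>{1..N}\<close>. All segment lengths
  thus share the exposed indices of a single set.\<close>

lemma exposed_initial_segments_le: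
  assumes "finite R"
  shows "(\<Sum>s\<in>{1..<N}. of_bool (\<not> free R {1..s} (Suc s)) :: real) \<le> real (card R)"
proof -
  have "Suc ` {s \<in> {1..<N}. \<not> free R {1..s} (Suc s)} \<subseteq> {k \<in> {1..N}. \<not> free R {1..N} k}"
  proof
    fix k assume "k \<in> Suc ` {s \<in> {1..<N}. \<not> free R {1..s} (Suc s)}"
    then obtain s where s: "k = Suc s" "s \<in> {1..<N}" "\<not> free R {1..s} (Suc s)" by auto
    have "free R {1..s} (Suc s) = free R {1..N} (Suc s)" using s(2) by (intro free_cong) auto
    then show "k \<in> {k \<in> {1..N}. \<not> free R {1..N} k}" using s by auto
  qed
  then have "card (Suc ` {s \<in> {1..<N}. \<not> free R {1..s} (Suc s)}) \<le> card {k \<in> {1..N}. \<not> free R {1..N} k}"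
    by (intro card_mono) auto
  also have "\<dots> \<le> card R" using assms by (intro card_exposed_le) auto
  finally have "card {s \<in> {1..<N}. \<not> free R {1..s} (Suc s)} \<le> card R" by (simp add: card_image)
  moreover have "(\<Sum>s\<in>{1..<N}. of_bool (\<not> free R {1..s} (Suc s)) :: real)
      = real (card {s \<in> {1..<N}. \<not> free R {1..s} (Suc s)})"
    by (simp add: of_bool_def sum.If_cases Int_def)
  ultimately show ?thesis by simp
qed

text \<open>Passing from \<open>{1..s}\<close> to \<open>{1..Suc s}\<close> changes the probability of a transcript noticeably only if
  \<open>Suc s\<close> is exposed. Which lengths are exposed after \<open>Suc m\<close> questions is determined by the
  first \<open>m\<close> answers, and there are at most \<open>Suc m\<close> of them.\<close>

lemma mass_Suc:
  assumes N: "N \<ge> 1"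
  shows "mass t (Suc m) \<le> 1 + real N * \<eta> + real (Suc m) * mass t m"
proof -
  let ?\<Theta> = "transcripts t (Suc m)"
  let ?P = "\<lambda>s. P t (Suc m) {1..s}"
  \<comment> \<open>At a free step the increase is the small flip error; at an exposed step the new
    probability itself serves as a trivial bound.\<close>
  define inc where "inc s \<tau> =
    (if free (rows \<tau>) {1..s} (Suc s) then \<bar>?P s \<tau> - ?P (Suc s) \<tau>\<bar> else ?P (Suc s) \<tau>)" for s \<tau>
  have inc_nonneg: "inc s \<tau> \<ge> 0" for s \<tau> by (simp add: inc_def obs_prob_nonneg)
  have step: "?P (Suc s) \<tau> \<le> ?P s \<tau> + inc s \<tau>" for s \<tau>
    using obs_prob_nonneg[of \<Omega> t "Suc m" "{1..s}" \<tau>] by (auto simp: inc_def)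
  have chain: "?P (Suc s) \<tau> \<le> ?P 1 \<tau> + (\<Sum>j\<in>{1..<Suc s}. inc j \<tau>)" for s \<tau>
  proof (induction s)
    case (Suc s)
    then show ?case using step[of "Suc s" \<tau>] by simp
  qed simp
  have "peak t (Suc m) \<tau> \<le> ?P 1 \<tau> + (\<Sum>j\<in>{1..<N}. inc j \<tau>)" for \<tau>
    unfolding peak_def
  proof (rule Max.boundedI)
    fix a assume "a \<in> (\<lambda>s. ?P s \<tau>) ` {1..N}"
    then obtain s where s: "a = ?P s \<tau>" "s \<in> {1..N}" by auto
    then obtain s' where s': "s = Suc s'" by (cases s) auto
    have "(\<Sum>j\<in>{1..<Suc s'}. inc j \<tau>) \<le> (\<Sum>j\<in>{1..<N}. inc j \<tau>)"
      using s s' inc_nonneg by (intro sum_mono2) auto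
    then show "a \<le> ?P 1 \<tau> + (\<Sum>j\<in>{1..<N}. inc j \<tau>)" using chain[of s' \<tau>] unfolding s(1) s' by linarith
  qed (use N in auto)
  then have "mass t (Suc m) \<le> (\<Sum>\<tau>\<in>?\<Theta>. ?P 1 \<tau> + (\<Sum>j\<in>{1..<N}. inc j \<tau>))"
    unfolding mass_def by (intro sum_mono)
  also have "\<dots> = 1 + (\<Sum>j\<in>{1..<N}. \<Sum>\<tau>\<in>?\<Theta>. inc j \<tau>)"
    using sum_transcripts_1[of "{1..1}" t "Suc m"] N by (simp add: sum.distrib sum.swap[of _ ?\<Theta>])
  also have "(\<Sum>j\<in>{1..<N}. \<Sum>\<tau>\<in>?\<Theta>. inc j \<tau>) \<le>
      (\<Sum>j\<in>{1..<N}. \<eta> + (\<Sum>\<tau>\<in>?\<Theta>. of_bool (\<not> free (rows \<tau>) {1..j} (Suc j)) * ?P (Suc j) \<tau>))"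
  proof (rule sum_mono)
    fix j assume j: "j \<in> {1..<N}"
    have "(\<Sum>\<tau>\<in>?\<Theta>. inc j \<tau>) =
        (\<Sum>\<tau>\<in>?\<Theta>. (if free (rows \<tau>) {1..j} (Suc j) then \<bar>?P j \<tau> - ?P (Suc j) \<tau>\<bar> else 0)
          + of_bool (\<not> free (rows \<tau>) {1..j} (Suc j)) * ?P (Suc j) \<tau>)"
      by (intro sum.cong) (auto simp: inc_def)
    also have "\<dots> = (\<Sum>\<tau> | \<tau> \<in> ?\<Theta> \<and> free (rows \<tau>) {1..j} (Suc j). \<bar>?P j \<tau> - ?P (Suc j) \<tau>\<bar>)
        + (\<Sum>\<tau>\<in>?\<Theta>. of_bool (\<not> free (rows \<tau>) {1..j} (Suc j)) * ?P (Suc j) \<tau>)"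
      using finite_transcripts[of t "Suc m"]
      by (simp add: sum.distrib sum.inter_filter del: One_nat_def)
    also have "(\<Sum>\<tau> | \<tau> \<in> ?\<Theta> \<and> free (rows \<tau>) {1..j} (Suc j). \<bar>?P j \<tau> - ?P (Suc j) \<tau>\<bar>) \<le> \<eta>"
      using flip[of "{1..j}" "Suc j" ?\<Theta> t "Suc m"] j finite_transcripts
      by (simp add: atLeastAtMostSuc_conv)
    finally show "(\<Sum>\<tau>\<in>?\<Theta>. inc j \<tau>) \<le>
        \<eta> + (\<Sum>\<tau>\<in>?\<Theta>. of_bool (\<not> free (rows \<tau>) {1..j} (Suc j)) * ?P (Suc j) \<tau>)" by simp
  qed
  also have "\<dots> \<le> real N * \<eta> + real (Suc m) * mass t m"
  proof -
    \<comment> \<open>\<open>ext\<close> recovers the first \<open>Suc m\<close> query sets from the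
      first \<open>m\<close> answers. The exposed terms can then be summed over transcripts of at
      most \<open>m\<close> answers, which yields \<open>mass t m\<close> instead of
      \<open>mass t (Suc m)\<close>.\<close>
    define ext where "ext \<sigma> = (SOME R. \<exists>F. take m (trace F t) = \<sigma> \<and> R = rows (take (Suc m) (trace F t)))" for \<sigma>
    have ext: "rows (take (Suc m) (trace F t)) = ext (take m (trace F t))" for F
      unfolding ext_def
    proof (rule some_equality[symmetric])
      fix R assume "\<exists>F'. take m (trace F' t) = take m (trace F t) \<and> R = rows (take (Suc m) (trace F' t))"
      then obtain F' where "take m (trace F' t) = take m (trace F t)"
        and R: "R = rows (take (Suc m) (trace F' t))" by blast
      from map_fst_take_Suc_trace_cong[OF this(1)]
      show "R = rows (take (Suc m) (trace F t))" unfolding R by (metis set_map)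
    qed blast
    have "(\<Sum>\<tau>\<in>?\<Theta>. of_bool (\<not> free (rows \<tau>) {1..j} (Suc j)) * ?P (Suc j) \<tau>)
        \<le> (\<Sum>\<sigma>\<in>transcripts t m. of_bool (\<not> free (ext \<sigma>) {1..j} (Suc j)) * peak t m \<sigma>)"
      if j: "j \<in> {1..<N}" for j
    proof -
      have sub: "{1..Suc j} \<subseteq> {1..N}" using j by auto
      have "(\<Sum>\<tau>\<in>?\<Theta>. of_bool (\<not> free (rows \<tau>) {1..j} (Suc j)) * ?P (Suc j) \<tau>)
          = average (\<lambda>\<omega>. of_bool (\<not> free (ext (obs t m {1..Suc j} \<omega>)) {1..j} (Suc j)))"
        unfolding sum_transcripts[OF sub] using ext by (simp add: obs_def)
      also have "\<dots> = (\<Sum>\<sigma>\<in>transcripts t m. of_bool (\<not> free (ext \<sigma>) {1..j} (Suc j)) * P t m {1..Suc j} \<sigma>)"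
        by (rule sum_transcripts[OF sub, symmetric])
      also have "\<dots> \<le> (\<Sum>\<sigma>\<in>transcripts t m. of_bool (\<not> free (ext \<sigma>) {1..j} (Suc j)) * peak t m \<sigma>)"
        using j by (intro sum_mono mult_left_mono P_le_peak) auto
      finally show ?thesis .
    qed
    then have "(\<Sum>j\<in>{1..<N}. \<Sum>\<tau>\<in>?\<Theta>. of_bool (\<not> free (rows \<tau>) {1..j} (Suc j)) * ?P (Suc j) \<tau>)
        \<le> (\<Sum>j\<in>{1..<N}. \<Sum>\<sigma>\<in>transcripts t m. of_bool (\<not> free (ext \<sigma>) {1..j} (Suc j)) * peak t m \<sigma>)"
      by (intro sum_mono)
    also have "\<dots> = (\<Sum>\<sigma>\<in>transcripts t m. \<Sum>j\<in>{1..<N}. of_bool (\<not> free (ext \<sigma>) {1..j} (Suc j)) * peak t m \<sigma>)"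
      by (rule sum.swap)
    also have "\<dots> = (\<Sum>\<sigma>\<in>transcripts t m. (\<Sum>j\<in>{1..<N}. of_bool (\<not> free (ext \<sigma>) {1..j} (Suc j))) * peak t m \<sigma>)"
      by (simp only: sum_distrib_right)
    also have "\<dots> \<le> (\<Sum>\<sigma>\<in>transcripts t m. real (Suc m) * peak t m \<sigma>)"
    proof (intro sum_mono mult_right_mono peak_nonneg N)
      fix \<sigma> assume "\<sigma> \<in> transcripts t m"
      then obtain T \<omega> where "\<sigma> = take m (trace (wsum \<omega> T) t)"
        by (auto simp: transcripts_def obs_def)
      then have e: "ext \<sigma> = rows (take (Suc m) (trace (wsum \<omega> T) t))" using ext by simp
      have "card (ext \<sigma>) \<le> Suc m"
        unfolding e by (rule order_trans[OF card_rows_le]) simp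
      then show "(\<Sum>j\<in>{1..<N}. of_bool (\<not> free (ext \<sigma>) {1..j} (Suc j))) \<le> real (Suc m)"
        using exposed_initial_segments_le[of "ext \<sigma>"] e
        by (metis (no_types, lifting) List.finite_set finite_imageI of_nat_le_iff order_trans)
    qed
    also have "\<dots> = real (Suc m) * mass t m" by (simp only: mass_def sum_distrib_left)
    finally have "(\<Sum>j\<in>{1..<N}. \<Sum>\<tau>\<in>?\<Theta>. of_bool (\<not> free (rows \<tau>) {1..j} (Suc j)) * ?P (Suc j) \<tau>)
        \<le> real (Suc m) * mass t m" .
    moreover have "(\<Sum>j\<in>{1..<N}. \<eta>) \<le> real N * \<eta>"
    proof -
      have "\<eta> \<ge> 0" using flip[of "{}" 1 "{}" t m] N by simp
      then show ?thesis by (simp add: mult_right_mono)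
    qed
    ultimately show ?thesis unfolding sum.distrib by linarith
  qed
  finally show ?thesis by simp
qed

text \<open>The offset 2 absorbs the additive term of the recursion
  \<open>mass t (Suc m) \<le> 2 + (m + 1) * mass t m\<close>, since
  \<open>(m + 3)! = 2 * (m + 2)! + (m + 1) * (m + 2)!\<close>.\<close>

lemma mass_le_fact:
  assumes "N \<ge> 1" "real N * \<eta> \<le> 1"
  shows "mass t m \<le> fact (m + 2)"
proof (induction m)
  case 0
  then show ?case using mass_0[OF assms(1), of t] by simp
next
  case (Suc m)
  have "mass t (Suc m) \<le> 2 + real (Suc m) * mass t m"
    using mass_Suc[OF assms(1), of t m] assms(2) by simp
  also have "\<dots> \<le> 2 * fact (m + 2) + real (Suc m) * fact (m + 2)"
    using mult_left_mono[OF Suc, of "real (Suc m)"] fact_ge_1[of "m + 2", where 'a = real] by linarith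
  also have "\<dots> = fact (Suc m + 2)" by (simp add: algebra_simps)
  finally show ?case .
qed

text \<open>By \<open>disj\<close> the output of a transcript is good for at most one size in
  \<open>A\<close>. After replacing probabilities by peaks and exchanging the sums, each transcript
  is counted at most once.\<close>

theorem initial_segment_success:
  assumes N: "N \<ge> 1" "real N * \<eta> \<le> 1"
    and len: "\<And>s \<omega>. \<lbrakk>s \<in> A; \<omega> \<in> \<Omega>\<rbrakk> \<Longrightarrow> length (trace (wsum \<omega> {1..s}) t) \<le> d"
    and A: "A \<subseteq> {1..N}" and disj: "\<And>s s' x. \<lbrakk>s \<in> A; s' \<in> A; good s x; good s' x\<rbrakk> \<Longrightarrow> s = s'"
  shows "(\<Sum>s\<in>A. average (\<lambda>\<omega>. of_bool (good s (outcome (wsum \<omega> {1..s}) t)))) \<le> fact (d + 2)"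
proof -
  have fin: "finite A" using A finite_subset by blast
  have "average (\<lambda>\<omega>. of_bool (good s (outcome (wsum \<omega> {1..s}) t)))
      \<le> (\<Sum>\<tau>\<in>transcripts t d. of_bool (good s (outcome_of t \<tau>)) * peak t d \<tau>)" if s: "s \<in> A" for s
  proof -
    have sN: "s \<in> {1..N}" and sub: "{1..s} \<subseteq> {1..N}" using s A by auto
    have "average (\<lambda>\<omega>. of_bool (good s (outcome (wsum \<omega> {1..s}) t)))
        = average (\<lambda>\<omega>. of_bool (good s (outcome_of t (obs t d {1..s} \<omega>))))"
      using len[OF s] by (intro average_cong) (simp add: obs_def outcome_of_trace)
    also have "\<dots> = (\<Sum>\<tau>\<in>transcripts t d. of_bool (good s (outcome_of t \<tau>)) * P t d {1..s} \<tau>)"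
      by (rule sum_transcripts[OF sub, symmetric])
    also have "\<dots> \<le> (\<Sum>\<tau>\<in>transcripts t d. of_bool (good s (outcome_of t \<tau>)) * peak t d \<tau>)"
      by (intro sum_mono mult_left_mono P_le_peak sN) auto
    finally show ?thesis .
  qed
  then have "(\<Sum>s\<in>A. average (\<lambda>\<omega>. of_bool (good s (outcome (wsum \<omega> {1..s}) t))))
      \<le> (\<Sum>s\<in>A. \<Sum>\<tau>\<in>transcripts t d. of_bool (good s (outcome_of t \<tau>)) * peak t d \<tau>)"
    by (rule sum_mono)
  also have "\<dots> = (\<Sum>\<tau>\<in>transcripts t d. (\<Sum>s\<in>A. of_bool (good s (outcome_of t \<tau>))) * peak t d \<tau>)"
    by (subst sum.swap) (simp only: sum_distrib_right)
  also have "\<dots> \<le> (\<Sum>\<tau>\<in>transcripts t d. 1 * peak t d \<tau>)"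
  proof (intro sum_mono mult_right_mono peak_nonneg N(1))
    fix \<tau>
    have "card {s \<in> A. good s (outcome_of t \<tau>)} \<le> 1"
      using disj by (intro card_le_Suc0_iff_eq[THEN iffD2, folded One_nat_def]) (use fin in auto)
    moreover have "(\<Sum>s\<in>A. of_bool (good s (outcome_of t \<tau>)) :: real) = real (card {s \<in> A. good s (outcome_of t \<tau>)})"
      using fin by (simp add: of_bool_def sum.If_cases Int_def)
    ultimately show "(\<Sum>s\<in>A. of_bool (good s (outcome_of t \<tau>)) :: real) \<le> 1" by simp
  qed
  also have "\<dots> = mass t d" by (simp add: mass_def)
  also have "\<dots> \<le> fact (d + 2)" by (rule mass_le_fact[OF N])
  finally show ?thesis .
qed

end

subsection \<open>Random supports\<close>

lemma binomial_central_le: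
  "((2 * m) choose m)\<^sup>2 * (2 * m + 1) \<le> 16 ^ m"
proof (induction m)
  case (Suc m)
  let ?c = "(2 * m) choose m" and ?c' = "(2 * Suc m) choose (Suc m)"
  \<comment> \<open>The factor \<open>2 * m + 1\<close> in the claim closes the induction: squaring
    this ratio leaves \<open>(2 * m + 1) * (2 * m + 3)\<close>, which is at most
    \<open>4 * (Suc m)\<^sup>2\<close>.\<close>
  have rec: "Suc m * ?c' = 2 * (2 * m + 1) * ?c"
  proof -
    have "Suc m * ?c' = 2 * (Suc m * (Suc (2 * m) choose m))"
      using Suc_times_binomial[of m "Suc (2 * m)"] by (simp del: binomial_Suc_Suc)
    also have "Suc (2 * m) choose m = Suc (2 * m) choose (Suc m)"
      using binomial_symmetric[of m "Suc (2 * m)"] by (simp del: binomial_Suc_Suc)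
    also have "Suc m * (Suc (2 * m) choose Suc m) = Suc (2 * m) * ?c"
      by (rule Suc_times_binomial)
    finally show ?thesis by (simp del: binomial_Suc_Suc)
  qed
  have "(Suc m)\<^sup>2 * (?c'\<^sup>2 * (2 * Suc m + 1)) = (Suc m * ?c')\<^sup>2 * (2 * m + 3)"
    by (simp add: power2_eq_square algebra_simps)
  also have "\<dots> = 4 * ((2 * m + 1) * (2 * m + 3)) * (?c\<^sup>2 * (2 * m + 1))"
    unfolding rec by (simp add: power2_eq_square algebra_simps)
  also have "\<dots> \<le> 4 * (4 * (Suc m)\<^sup>2) * 16 ^ m"
  proof (rule mult_le_mono[OF mult_le_mono2 Suc])
    show "(2 * m + 1) * (2 * m + 3) \<le> 4 * (Suc m)\<^sup>2" by (simp add: power2_eq_square algebra_simps)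
  qed
  also have "\<dots> = (Suc m)\<^sup>2 * 16 ^ Suc m" by simp
  finally show ?case by (rule mult_left_le_imp_le) simp
qed simp

text \<open>In an odd row the largest coefficient is half the central coefficient of the next even
  row, whose bound suffices.\<close>

lemma binomial_sq_le: "(f choose k)\<^sup>2 * (f + 1) \<le> 4 ^ f"
proof (cases "even f")
  case True
  then obtain m where m: "f = 2 * m" by auto
  have "f choose k \<le> f choose m" using binomial_maximum[of f k] m by simp
  then have "(f choose k)\<^sup>2 * (f + 1) \<le> (f choose m)\<^sup>2 * (f + 1)"
    by (intro mult_le_mono1 power_mono) auto
  also have "\<dots> \<le> 4 ^ f" using binomial_central_le[of m] m by (simp add: power_mult)
  finally show ?thesis .
next
  case False
  then obtain m where m: "f = Suc (2 * m)" by (auto elim: oddE)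
  have "f choose k \<le> f choose m" using binomial_maximum[of f k] m by simp
  then have "2 * (f choose k) \<le> (2 * Suc m) choose (Suc m)"
    using binomial_symmetric[of m f] m by simp
  then have "(2 * (f choose k))\<^sup>2 * (f + 1) \<le> ((2 * Suc m) choose (Suc m))\<^sup>2 * (2 * Suc m + 1)"
    using m by (intro mult_le_mono power_mono) auto
  also have "\<dots> \<le> 16 ^ Suc m" by (rule binomial_central_le)
  also have "\<dots> = 4 * 4 ^ f" using m by (simp add: power_mult)
  finally show ?thesis by (simp add: power2_eq_square)
qed

lemma binomial_le_sqrt: "real (f choose k) \<le> 2 ^ f / sqrt (real (f + 1))"
proof -
  have "(real (f choose k))\<^sup>2 * real (f + 1) \<le> 4 ^ f"
    using binomial_sq_le[of f k] by (metis (mono_tags) of_nat_le_iff of_nat_mult of_nat_numeral of_nat_power)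
  then have "sqrt ((real (f choose k))\<^sup>2 * real (f + 1)) \<le> sqrt (4 ^ f)" by (rule real_sqrt_le_mono)
  moreover have "sqrt (4 ^ f) = 2 ^ f"
    by (metis real_sqrt_four real_sqrt_power)
  ultimately have "real (f choose k) * sqrt (real (f + 1)) \<le> 2 ^ f"
    by (simp only: real_sqrt_mult real_sqrt_abs abs_of_nat)
  then show ?thesis by (simp add: pos_le_divide_eq)
qed

section \<open>Toggling free indices of a support\<close>

lemma sym_diff_cancel: "sym_diff (sym_diff T A) A = T"
  by auto

lemma free_sym_diff_single:
  assumes "free R T i"
  shows "free R (sym_diff T {i}) j \<longleftrightarrow> free R T j"
proof (cases "i \<in> T")
  case True
  have "free R (T - {i}) i" using assms by (subst free_cong[of _ _ T]) auto
  from free_insert[OF this, of j] True show ?thesis by (simp add: insert_absorb Un_Diff)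
next
  case False
  then show ?thesis using free_insert[OF assms, of j] by simp
qed

lemma free_sym_diff:
  assumes "finite A" "\<And>i. i \<in> A \<Longrightarrow> free R T i"
  shows "free R (sym_diff T A) j \<longleftrightarrow> free R T j"
  using assms
proof (induction A arbitrary: j)
  case (insert i A)
  have eq: "sym_diff T (insert i A) = sym_diff (sym_diff T A) {i}" using insert.hyps by auto
  have "free R (sym_diff T A) i" using insert by simp
  from free_sym_diff_single[OF this] show ?case using insert unfolding eq by simp
qed simp

lemma card_Pow_inter:
  assumes "finite J" "F \<subseteq> J"
  shows "card {A \<in> Pow J. Q (A \<inter> F)} = 2 ^ card (J - F) * card {A \<in> Pow F. Q A}"
proof -
  have "bij_betw (\<lambda>A. (A - F, A \<inter> F)) {A \<in> Pow J. Q (A \<inter> F)} (Pow (J - F) \<times> {A \<in> Pow F. Q A})"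
    by (rule bij_betwI[where g = "\<lambda>(A, B). A \<union> B"])
      (use assms in \<open>auto simp: Int_Un_distrib2 Diff_eq intro!: arg_cong[where f = Q]
        elim!: back_subst[where P = Q]\<close>)
  then show ?thesis using assms
    by (simp add: bij_betw_same_card card_cartesian_product card_Pow)
qed

text \<open>Toggling within \<open>F\<close> replaces \<open>T \<inter> F\<close> by a subset
  \<open>C\<close> of \<open>F\<close>, with different \<open>A\<close> giving different
  \<open>C\<close>, and the size becomes \<open>card (T - F) + card C\<close>. Each size in
  \<open>Win\<close> thus fixes \<open>card C\<close> and leaves a binomial coefficient of
  choices.\<close>

lemma card_sym_diff_window:
  assumes "finite T" "finite F" "finite Win"
  shows "real (card {A \<in> Pow F. card (sym_diff T A) \<in> Win}) \<le> real (card Win) * (2 ^ card F / sqrt (real (card F + 1)))"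
proof -
  let ?r = "card (T - F)"
  have "sym_diff (T \<inter> F) ` {A \<in> Pow F. card (sym_diff T A) \<in> Win} \<subseteq>
      (\<Union>s\<in>Win. {C. C \<subseteq> F \<and> card C = s - ?r})"
  proof
    fix C assume "C \<in> sym_diff (T \<inter> F) ` {A \<in> Pow F. card (sym_diff T A) \<in> Win}"
    then obtain A where A: "A \<subseteq> F" "card (sym_diff T A) \<in> Win" "C = sym_diff (T \<inter> F) A" by auto
    have "sym_diff T A = (T - F) \<union> C" using A by auto
    moreover have "(T - F) \<inter> C = {}" using A by auto
    moreover have "finite C" using A assms finite_subset by blast
    ultimately have "card (sym_diff T A) = ?r + card C" using assms by (simp add: card_Un_disjoint)
    then have "card C = card (sym_diff T A) - ?r" by simp
    moreover have "C \<subseteq> F" using A by auto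
    ultimately show "C \<in> (\<Union>s\<in>Win. {C. C \<subseteq> F \<and> card C = s - ?r})" using A(2) by blast
  qed
  moreover have "inj_on (sym_diff (T \<inter> F)) {A \<in> Pow F. card (sym_diff T A) \<in> Win}"
    by (intro inj_onI) (metis Un_commute sym_diff_cancel)
  ultimately have "card {A \<in> Pow F. card (sym_diff T A) \<in> Win} \<le> card (\<Union>s\<in>Win. {C. C \<subseteq> F \<and> card C = s - ?r})"
    using assms by (intro card_inj_on_le[of "sym_diff (T \<inter> F)"]) auto
  also have "\<dots> \<le> (\<Sum>s\<in>Win. card {C. C \<subseteq> F \<and> card C = s - ?r})" using assms(3) by (rule card_UN_le)
  also have "\<dots> = (\<Sum>s\<in>Win. card F choose (s - ?r))" using assms by (simp add: n_subsets)
  finally have "real (card {A \<in> Pow F. card (sym_diff T A) \<in> Win}) \<le> (\<Sum>s\<in>Win. real (card F choose (s - ?r)))"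
    by (simp only: of_nat_sum[symmetric] of_nat_le_iff)
  also have "\<dots> \<le> (\<Sum>s\<in>Win. 2 ^ card F / sqrt (real (card F + 1)))"
    by (intro sum_mono binomial_le_sqrt)
  finally show ?thesis by simp
qed

context masked_weights
begin

abbreviation "J \<equiv> {2..N}"
text \<open>Keeping 1 in every support makes it nonempty, as the support of a distribution must be;
  the other indices act as independent fair bits.\<close>

definition supports :: "nat set set" where "supports = insert 1 ` Pow J"

definition free_bits :: "(nat set \<times> nat) list \<Rightarrow> nat set \<Rightarrow> nat set" where
  "free_bits \<tau> T = {i \<in> J. free (rows \<tau>) T i}"

text \<open>Free bits remain free when toggled, so each transcript splits the supports into subcubes on
  which its probability is nearly constant and the support size is binomially distributed.\<close>

definition toggle :: "(nat set \<times> nat) list \<Rightarrow> nat set \<Rightarrow> nat set \<Rightarrow> nat set" where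
  "toggle \<tau> A T = sym_diff T (A \<inter> free_bits \<tau> T)"

lemma finite_free_bits: "finite (free_bits \<tau> T)" "free_bits \<tau> T \<subseteq> J"
  by (auto simp: free_bits_def)

lemma supports_iff:
  assumes "N \<ge> 1"
  shows "T \<in> supports \<longleftrightarrow> 1 \<in> T \<and> T \<subseteq> {1..N}"
proof
  assume T: "1 \<in> T \<and> T \<subseteq> {1..N}"
  then have "T = insert 1 (T - {1})" by auto
  moreover have "T - {1} \<in> Pow J"
  proof -
    have "k \<in> J" if "k \<in> T" "k \<noteq> 1" for k using that T by (auto dest!: subsetD[of T _ k])
    then show ?thesis by blast
  qed
  ultimately show "T \<in> supports" unfolding supports_def by blast
next
  assume "T \<in> supports"
  then show "1 \<in> T \<and> T \<subseteq> {1..N}" using assms by (auto simp: supports_def)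
qed

lemma finite_supports: "finite supports" by (simp add: supports_def)

lemma card_supports: "card supports = 2 ^ card J"
proof -
  have "inj_on (insert 1) (Pow J)" by (rule inj_on_inverseI[where g = "\<lambda>T. T - {1}"]) auto
  then show ?thesis by (simp add: supports_def card_image card_Pow)
qed

lemma sym_diff_supports:
  assumes "N \<ge> 1" "T \<in> supports" "A \<subseteq> J"
  shows "sym_diff T A \<in> supports"
  using assms(2,3) unfolding supports_iff[OF assms(1)] by fastforce

lemma free_bits_sym_diff:
  assumes "A \<subseteq> free_bits \<tau> T"
  shows "free_bits \<tau> (sym_diff T A) = free_bits \<tau> T"
proof -
  have "free (rows \<tau>) (sym_diff T A) j = free (rows \<tau>) T j" for j
    using assms finite_subset[OF assms finite_free_bits(1)]
    by (intro free_sym_diff) (auto simp: free_bits_def)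
  then show ?thesis by (simp add: free_bits_def)
qed

lemma free_bits_toggle: "free_bits \<tau> (toggle \<tau> A T) = free_bits \<tau> T"
  unfolding toggle_def by (rule free_bits_sym_diff) auto

lemma toggle_toggle: "toggle \<tau> A (toggle \<tau> A T) = T"
  unfolding toggle_def[of \<tau> A "toggle \<tau> A T"] free_bits_toggle by (auto simp: toggle_def)

lemma toggle_supports: "\<lbrakk>N \<ge> 1; T \<in> supports\<rbrakk> \<Longrightarrow> toggle \<tau> A T \<in> supports"
  unfolding toggle_def using finite_free_bits(2)[of \<tau> T] by (intro sym_diff_supports) blast+

text \<open>For a fixed transcript toggling is an involution on the supports, because it does not
  change which bits are free.\<close>

lemma sum_toggle:
  assumes "N \<ge> 1"
  shows "(\<Sum>T\<in>supports. h (toggle \<tau> A T)) = (\<Sum>T\<in>supports. h T)"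
  by (rule sum.reindex_bij_witness[of _ "toggle \<tau> A" "toggle \<tau> A"])
    (auto simp: toggle_toggle toggle_supports[OF assms])

lemma flip_single:
  assumes N: "N \<ge> 1" and T: "T \<in> supports" and i: "i \<in> J"
  shows "(\<Sum>\<tau> | \<tau> \<in> transcripts t m \<and> i \<in> free_bits \<tau> T. \<bar>P t m (sym_diff T {i}) \<tau> - P t m T \<tau>\<bar>) \<le> \<eta>"
proof -
  have sub: "T \<subseteq> {1..N}" using T supports_iff[OF N] by blast
  have iN: "i \<in> {1..N}" using i by auto
  show ?thesis
  proof (cases "i \<in> T")
    case True
    have "free R (T - {i}) i = free R T i" for R by (rule free_cong) auto
    moreover have "insert i (T - {i}) = T" "sym_diff T {i} = T - {i}" using True by auto
    ultimately show ?thesis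
      using flip[of "T - {i}" i "transcripts t m" t m] sub iN finite_transcripts i
      by (auto simp: free_bits_def)
  next
    case False
    then have "sym_diff T {i} = insert i T" by auto
    then show ?thesis
      using flip[of T i "transcripts t m" t m] sub iN finite_transcripts i False
      by (simp add: free_bits_def abs_minus_commute)
  qed
qed

text \<open>A hybrid argument toggles one index of \<open>A\<close> at a time. By
  \<open>sum_toggle\<close> the intermediate supports again run through all supports, so each index
  costs at most \<open>\<eta>\<close> per support.\<close>

lemma toggle_close:
  assumes N: "N \<ge> 1" and A: "A \<subseteq> J"
  shows "(\<Sum>\<tau>\<in>transcripts t m. \<Sum>T\<in>supports. \<bar>P t m (toggle \<tau> A T) \<tau> - P t m T \<tau>\<bar>)
    \<le> real (card A) * (real (card supports) * \<eta>)"
proof -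
  have "finite A" using A finite_subset by blast
  then show ?thesis using A
  proof (induction A)
    case empty
    then show ?case by (simp add: toggle_def)
  next
    case (insert i A)
    let ?\<Theta> = "transcripts t m" and ?P = "P t m"
    define g where "g \<tau> T = of_bool (i \<in> free_bits \<tau> T) * \<bar>?P (sym_diff T {i}) \<tau> - ?P T \<tau>\<bar>" for \<tau> T
    have "\<bar>?P (toggle \<tau> (insert i A) T) \<tau> - ?P T \<tau>\<bar>
        \<le> g \<tau> (toggle \<tau> A T) + \<bar>?P (toggle \<tau> A T) \<tau> - ?P T \<tau>\<bar>" for \<tau> T
    proof (cases "i \<in> free_bits \<tau> T")
      case True
      then have "toggle \<tau> (insert i A) T = sym_diff (toggle \<tau> A T) {i}"
        using insert.hyps by (auto simp: toggle_def)
      then show ?thesis using True by (simp add: g_def free_bits_toggle)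
    next
      case False
      then have "toggle \<tau> (insert i A) T = toggle \<tau> A T"
        by (auto simp: toggle_def)
      then show ?thesis by (simp add: g_def)
    qed
    then have "(\<Sum>\<tau>\<in>?\<Theta>. \<Sum>T\<in>supports. \<bar>?P (toggle \<tau> (insert i A) T) \<tau> - ?P T \<tau>\<bar>)
        \<le> (\<Sum>\<tau>\<in>?\<Theta>. \<Sum>T\<in>supports. g \<tau> (toggle \<tau> A T) + \<bar>?P (toggle \<tau> A T) \<tau> - ?P T \<tau>\<bar>)"
      by (intro sum_mono)
    also have "\<dots> = (\<Sum>\<tau>\<in>?\<Theta>. \<Sum>T\<in>supports. g \<tau> T)
        + (\<Sum>\<tau>\<in>?\<Theta>. \<Sum>T\<in>supports. \<bar>?P (toggle \<tau> A T) \<tau> - ?P T \<tau>\<bar>)"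
      by (simp add: sum.distrib sum_toggle[OF N])
    also have "(\<Sum>\<tau>\<in>?\<Theta>. \<Sum>T\<in>supports. g \<tau> T) = (\<Sum>T\<in>supports. \<Sum>\<tau>\<in>?\<Theta>. g \<tau> T)"
      by (rule sum.swap)
    also have "\<dots> \<le> (\<Sum>T\<in>supports. \<eta>)"
    proof (rule sum_mono)
      fix T assume T: "T \<in> supports"
      have "(\<Sum>\<tau>\<in>?\<Theta>. g \<tau> T)
          = (\<Sum>\<tau> | \<tau> \<in> ?\<Theta> \<and> i \<in> free_bits \<tau> T. \<bar>?P (sym_diff T {i}) \<tau> - ?P T \<tau>\<bar>)"
        unfolding g_def using finite_transcripts[of t m]
        by (intro sum.mono_neutral_cong_right) auto
      also have "\<dots> \<le> \<eta>" using insert.prems by (intro flip_single N T) auto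
      finally show "(\<Sum>\<tau>\<in>?\<Theta>. g \<tau> T) \<le> \<eta>" .
    qed
    also have "(\<Sum>\<tau>\<in>?\<Theta>. \<Sum>T\<in>supports. \<bar>?P (toggle \<tau> A T) \<tau> - ?P T \<tau>\<bar>)
        \<le> real (card A) * (real (card supports) * \<eta>)"
      using insert by simp
    finally show ?case using insert.hyps by (simp add: algebra_simps)
  qed
qed

text \<open>Flipping bit \<open>i\<close> barely changes the probability that \<open>i\<close> stays free, hence exposed indices outside
  the support are about as frequent as exposed indices inside it, and the latter are linearly
  independent columns.\<close>

lemma sum_exposed:
  assumes N: "N \<ge> 1"
  shows "(\<Sum>T\<in>supports. \<Sum>\<tau>\<in>transcripts t m. real (card (J - free_bits \<tau> T)) * P t m T \<tau>)
    \<le> real (card supports) * (2 * real m + real N * \<eta>)"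
proof -
  let ?\<Theta> = "transcripts t m" and ?P = "P t m"
  define e where "e i T = (\<Sum>\<tau>\<in>?\<Theta>. of_bool (i \<notin> free_bits \<tau> T) * ?P T \<tau>)" for i T
  have e_nonneg: "e i T \<ge> 0" for i T
    unfolding e_def by (intro sum_nonneg mult_nonneg_nonneg obs_prob_nonneg) auto
  have \<eta>_nonneg: "\<eta> \<ge> 0" using flip[of "{}" 1 "{}" t m] N by simp
  \<comment> \<open>\<open>flip\<close> controls only transcripts leaving \<open>i\<close> free, so
    exposure probabilities are compared through their complements. Membership of \<open>i\<close>
    itself does not influence whether \<open>i\<close> is free.\<close>
  have e_flip: "e i T \<le> e i (insert i T) + \<eta>" if T: "T \<in> supports" and i: "i \<in> J" "i \<notin> T" for i T
  proof -
    have sub: "T \<subseteq> {1..N}" "insert i T \<subseteq> {1..N}" using T supports_iff[OF N] i by auto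
    have same: "i \<in> free_bits \<tau> (insert i T) \<longleftrightarrow> i \<in> free_bits \<tau> T" for \<tau>
      using free_cong[of "insert i T" i T "rows \<tau>"] by (auto simp: free_bits_def)
    have sd: "sym_diff T {i} = insert i T" using i by auto
    have "e i T' = 1 - (\<Sum>\<tau> | \<tau> \<in> ?\<Theta> \<and> i \<in> free_bits \<tau> T. ?P T' \<tau>)"
      if "T' \<subseteq> {1..N}" "\<And>\<tau>. i \<in> free_bits \<tau> T' \<longleftrightarrow> i \<in> free_bits \<tau> T" for T'
    proof -
      have "(\<Sum>\<tau>\<in>?\<Theta>. ?P T' \<tau>) = (\<Sum>\<tau>\<in>?\<Theta>. of_bool (i \<notin> free_bits \<tau> T') * ?P T' \<tau>
          + (if i \<in> free_bits \<tau> T then ?P T' \<tau> else 0))"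
        using that(2) by (intro sum.cong) auto
      then show ?thesis
        using sum_transcripts_1[OF that(1), of t m] finite_transcripts[of t m]
        by (simp add: e_def sum.distrib sum.inter_filter)
    qed
    then have "e i T - e i (insert i T) = (\<Sum>\<tau> | \<tau> \<in> ?\<Theta> \<and> i \<in> free_bits \<tau> T. ?P (insert i T) \<tau> - ?P T \<tau>)"
      using sub same by (simp add: sum_subtractf)
    also have "\<dots> \<le> (\<Sum>\<tau> | \<tau> \<in> ?\<Theta> \<and> i \<in> free_bits \<tau> T. \<bar>?P (sym_diff T {i}) \<tau> - ?P T \<tau>\<bar>)"
      unfolding sd by (intro sum_mono) auto
    also have "\<dots> \<le> \<eta>" by (rule flip_single[OF N T i(1)])
    finally show ?thesis by simp
  qed
  have sum_i: "(\<Sum>T\<in>supports. e i T) \<le> 2 * (\<Sum>T\<in>supports. of_bool (i \<in> T) * e i T) + real (card supports) * \<eta>"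
    if i: "i \<in> J" for i
  proof -
    have "(\<Sum>T\<in>supports. of_bool (i \<notin> T) * e i T)
        \<le> (\<Sum>T\<in>supports. of_bool (i \<notin> T) * e i (sym_diff T {i}) + \<eta>)"
    proof (rule sum_mono)
      fix T assume "T \<in> supports"
      then show "of_bool (i \<notin> T) * e i T \<le> of_bool (i \<notin> T) * e i (sym_diff T {i}) + \<eta>"
        using e_flip[of T i] i \<eta>_nonneg by (cases "i \<in> T") auto
    qed
    also have "\<dots> = (\<Sum>T\<in>supports. of_bool (i \<notin> T) * e i (sym_diff T {i})) + real (card supports) * \<eta>"
      by (simp add: sum.distrib)
    also have "(\<Sum>T\<in>supports. of_bool (i \<notin> T) * e i (sym_diff T {i})) = (\<Sum>T\<in>supports. of_bool (i \<in> T) * e i T)"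
      by (rule sum.reindex_bij_witness[of _ "\<lambda>T. sym_diff T {i}" "\<lambda>T. sym_diff T {i}"])
        (use i in \<open>auto simp: sym_diff_supports[OF N] simp del: Un_insert_right Diff_insert\<close>)
    finally have "(\<Sum>T\<in>supports. of_bool (i \<notin> T) * e i T)
        \<le> (\<Sum>T\<in>supports. of_bool (i \<in> T) * e i T) + real (card supports) * \<eta>" .
    moreover have "(\<Sum>T\<in>supports. e i T)
        = (\<Sum>T\<in>supports. of_bool (i \<in> T) * e i T) + (\<Sum>T\<in>supports. of_bool (i \<notin> T) * e i T)"
      unfolding sum.distrib[symmetric] by (intro sum.cong) auto
    ultimately show ?thesis by linarith
  qed
  have pivots: "(\<Sum>i\<in>J. of_bool (i \<in> T) * e i T) \<le> real m" if T: "T \<in> supports" for T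
  proof -
    have sub: "T \<subseteq> {1..N}" using T supports_iff[OF N] by auto
    have "(\<Sum>i\<in>J. of_bool (i \<in> T) * e i T)
        = (\<Sum>\<tau>\<in>?\<Theta>. (\<Sum>i\<in>J. of_bool (i \<in> T) * of_bool (i \<notin> free_bits \<tau> T)) * ?P T \<tau>)"
      unfolding e_def sum_distrib_left sum_distrib_right by (subst sum.swap) (simp only: mult.assoc)
    also have "\<dots> \<le> (\<Sum>\<tau>\<in>?\<Theta>. real m * ?P T \<tau>)"
    proof (intro sum_mono mult_right_mono obs_prob_nonneg)
      fix \<tau> assume "\<tau> \<in> ?\<Theta>"
      then have len: "length \<tau> \<le> m" by (auto simp: transcripts_def length_obs)
      have "(\<Sum>i\<in>J. of_bool (i \<in> T) * of_bool (i \<notin> free_bits \<tau> T) :: real)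
          = real (card {i \<in> J. i \<in> T \<and> i \<notin> free_bits \<tau> T})"
        unfolding of_bool_conj[symmetric] by (simp add: of_bool_def sum.If_cases Int_def conj_ac)
      also have "\<dots> \<le> real (card {k \<in> T. \<not> free (rows \<tau>) T k})"
        using sub finite_subset[OF sub] by (intro of_nat_mono card_mono) (auto simp: free_bits_def)
      also have "\<dots> \<le> real (card (rows \<tau>))"
        using finite_subset[OF sub] by (intro of_nat_mono card_exposed_le) auto
      also have "\<dots> \<le> real m" using card_rows_le[of \<tau>] len by simp
      finally show "(\<Sum>i\<in>J. of_bool (i \<in> T) * of_bool (i \<notin> free_bits \<tau> T)) \<le> real m" .
    qed
    also have "\<dots> = real m" using sum_transcripts_1[OF sub, of t m] by (simp flip: sum_distrib_left)
    finally show ?thesis .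
  qed
  have "(\<Sum>T\<in>supports. \<Sum>\<tau>\<in>?\<Theta>. real (card (J - free_bits \<tau> T)) * ?P T \<tau>)
      = (\<Sum>T\<in>supports. \<Sum>i\<in>J. e i T)"
  proof (rule sum.cong[OF refl])
    fix T
    have "(\<Sum>i\<in>J. e i T) = (\<Sum>\<tau>\<in>?\<Theta>. (\<Sum>i\<in>J. of_bool (i \<notin> free_bits \<tau> T)) * ?P T \<tau>)"
      unfolding e_def sum_distrib_right by (rule sum.swap)
    also have "\<dots> = (\<Sum>\<tau>\<in>?\<Theta>. real (card (J - free_bits \<tau> T)) * ?P T \<tau>)"
      by (simp add: of_bool_def sum.If_cases set_diff_eq Int_def)
    finally show "(\<Sum>\<tau>\<in>?\<Theta>. real (card (J - free_bits \<tau> T)) * ?P T \<tau>) = (\<Sum>i\<in>J. e i T)" by simp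
  qed
  also have "\<dots> = (\<Sum>i\<in>J. \<Sum>T\<in>supports. e i T)" by (rule sum.swap)
  also have "\<dots> \<le> (\<Sum>i\<in>J. 2 * (\<Sum>T\<in>supports. of_bool (i \<in> T) * e i T) + real (card supports) * \<eta>)"
    by (intro sum_mono sum_i)
  also have "\<dots> = 2 * (\<Sum>T\<in>supports. \<Sum>i\<in>J. of_bool (i \<in> T) * e i T) + real (card J) * (real (card supports) * \<eta>)"
    by (simp add: sum.distrib sum_distrib_left[symmetric] sum.swap[of _ supports])
  also have "\<dots> \<le> 2 * (\<Sum>T\<in>supports. real m) + real N * (real (card supports) * \<eta>)"
    using \<eta>_nonneg by (intro add_mono mult_left_mono mult_right_mono sum_mono pivots) auto
  also have "\<dots> = real (card supports) * (2 * real m + real N * \<eta>)" by (simp add: algebra_simps)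
  finally show ?thesis .
qed

text \<open>Transcripts exposing at least \<open>M\<close> bits are handled by Markov's inequality
  and \<open>sum_exposed\<close>. On the others, averaging over toggles makes the size a shifted
  binomial variable on at least \<open>N - M\<close> fair bits, which hits a window of
  \<open>w\<close> sizes with probability at most \<open>w / sqrt (N - M)\<close>.\<close>

theorem random_support_success:
  assumes N: "N \<ge> 1" and M: "0 < M" "M < N"
    and len: "\<And>T \<omega>. \<lbrakk>T \<in> supports; \<omega> \<in> \<Omega>\<rbrakk> \<Longrightarrow> length (trace (wsum \<omega> T) t) \<le> d"
    and win: "\<And>x. real (card {s \<in> {1..N}. good s x}) \<le> w"
  shows "(\<Sum>T\<in>supports. average (\<lambda>\<omega>. of_bool (good (card T) (outcome (wsum \<omega> T) t)))) / real (card supports)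
    \<le> (2 * real d + real N * \<eta>) / real M + real N * \<eta> + w / sqrt (real (N - M))"
proof -
  let ?\<Theta> = "transcripts t d" and ?P = "P t d"
  define g where "g \<tau> T = (of_bool (good (card T) (outcome_of t \<tau>)) :: real)" for \<tau> and T :: "nat set"
  define few where "few \<tau> T = (of_bool (card (J - free_bits \<tau> T) < M) :: real)" for \<tau> T
  define n where "n = real (card supports)"
  have n_pos: "n > 0" unfolding n_def card_supports by simp
  have \<eta>_nonneg: "\<eta> \<ge> 0" using flip[of "{}" 1 "{}" t d] N by simp
  have w_nonneg: "w \<ge> 0" using win[of 0] by (rule order_trans[OF of_nat_0_le_iff])
  have "(\<Sum>T\<in>supports. average (\<lambda>\<omega>. of_bool (good (card T) (outcome (wsum \<omega> T) t))))
      = (\<Sum>T\<in>supports. \<Sum>\<tau>\<in>?\<Theta>. g \<tau> T * ?P T \<tau>)"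
  proof (rule sum.cong[OF refl])
    fix T assume T: "T \<in> supports"
    then have sub: "T \<subseteq> {1..N}" using supports_iff[OF N] by blast
    have "average (\<lambda>\<omega>. of_bool (good (card T) (outcome (wsum \<omega> T) t)))
        = average (\<lambda>\<omega>. g (obs t d T \<omega>) T)"
      using len[OF T] by (intro average_cong) (simp add: g_def obs_def outcome_of_trace)
    then show "average (\<lambda>\<omega>. of_bool (good (card T) (outcome (wsum \<omega> T) t))) = (\<Sum>\<tau>\<in>?\<Theta>. g \<tau> T * ?P T \<tau>)"
      using sum_transcripts[OF sub, of "\<lambda>\<tau>. g \<tau> T" t d] by simp
  qed
  also have "\<dots> \<le> (\<Sum>T\<in>supports. \<Sum>\<tau>\<in>?\<Theta>. real (card (J - free_bits \<tau> T)) * ?P T \<tau> / real M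
      + few \<tau> T * g \<tau> T * ?P T \<tau>)"
  proof (intro sum_mono)
    fix T \<tau>
    show "g \<tau> T * ?P T \<tau> \<le> real (card (J - free_bits \<tau> T)) * ?P T \<tau> / real M + few \<tau> T * g \<tau> T * ?P T \<tau>"
    proof (cases "card (J - free_bits \<tau> T) < M")
      case True
      then show ?thesis using obs_prob_nonneg[of \<Omega> t d T \<tau>] by (simp add: few_def)
    next
      case False
      then have "real M \<le> real (card (J - free_bits \<tau> T))" by simp
      then have "1 * ?P T \<tau> \<le> real (card (J - free_bits \<tau> T)) / real M * ?P T \<tau>"
        using M(1) by (intro mult_right_mono obs_prob_nonneg) (simp add: field_simps)
      moreover have "g \<tau> T * ?P T \<tau> \<le> 1 * ?P T \<tau>"
        by (intro mult_right_mono obs_prob_nonneg) (simp add: g_def)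
      ultimately show ?thesis using False by (simp add: few_def)
    qed
  qed
  also have "\<dots> = (\<Sum>T\<in>supports. \<Sum>\<tau>\<in>?\<Theta>. real (card (J - free_bits \<tau> T)) * ?P T \<tau>) / real M
      + (\<Sum>\<tau>\<in>?\<Theta>. \<Sum>T\<in>supports. few \<tau> T * g \<tau> T * ?P T \<tau>)"
    by (simp add: sum.distrib sum_divide_distrib sum.swap[of _ supports ?\<Theta>])
  also have "\<dots> \<le> n * (2 * real d + real N * \<eta>) / real M + n * (real N * \<eta> + w / sqrt (real (N - M)))"
  proof (rule add_mono)
    show "(\<Sum>T\<in>supports. \<Sum>\<tau>\<in>?\<Theta>. real (card (J - free_bits \<tau> T)) * ?P T \<tau>) / real M
        \<le> n * (2 * real d + real N * \<eta>) / real M"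
      unfolding n_def by (intro divide_right_mono sum_exposed N) simp
  next
    let ?S = "\<Sum>\<tau>\<in>?\<Theta>. \<Sum>T\<in>supports. few \<tau> T * g \<tau> T * ?P T \<tau>"
    \<comment> \<open>One copy of the sum is taken for every \<open>A\<close>; by
      \<open>sum_toggle\<close> each copy may be evaluated at the supports toggled by its own
      \<open>A\<close>.\<close>
    have "2 ^ card J * ?S = (\<Sum>A\<in>Pow J. ?S)" by (simp add: card_Pow)
    also have "\<dots> = (\<Sum>A\<in>Pow J. \<Sum>\<tau>\<in>?\<Theta>. \<Sum>T\<in>supports.
        few \<tau> (toggle \<tau> A T) * g \<tau> (toggle \<tau> A T) * ?P (toggle \<tau> A T) \<tau>)"
    proof -
      have "(\<Sum>T\<in>supports. few \<tau> (toggle \<tau> A T) * g \<tau> (toggle \<tau> A T) * ?P (toggle \<tau> A T) \<tau>)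
          = (\<Sum>T\<in>supports. few \<tau> T * g \<tau> T * ?P T \<tau>)" for \<tau> A
        by (rule sum_toggle[OF N])
      then show ?thesis by simp
    qed
    \<comment> \<open>Only the transcript probability is moved back to \<open>T\<close>, at a cost
      bounded by \<open>toggle_close\<close>; \<open>g\<close> keeps the toggled support.\<close>
    also have "\<dots> \<le> (\<Sum>A\<in>Pow J. \<Sum>\<tau>\<in>?\<Theta>. \<Sum>T\<in>supports.
        \<bar>?P (toggle \<tau> A T) \<tau> - ?P T \<tau>\<bar> + few \<tau> T * g \<tau> (toggle \<tau> A T) * ?P T \<tau>)"
    proof (intro sum_mono)
      fix A \<tau> T
      have few: "few \<tau> (toggle \<tau> A T) = few \<tau> T" by (simp add: few_def free_bits_toggle)
      have b: "few \<tau> T * g \<tau> (toggle \<tau> A T) \<in> {0, 1}" by (auto simp: few_def g_def)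
      show "few \<tau> (toggle \<tau> A T) * g \<tau> (toggle \<tau> A T) * ?P (toggle \<tau> A T) \<tau>
          \<le> \<bar>?P (toggle \<tau> A T) \<tau> - ?P T \<tau>\<bar> + few \<tau> T * g \<tau> (toggle \<tau> A T) * ?P T \<tau>"
        unfolding few using b by auto
    qed
    also have "\<dots> = (\<Sum>A\<in>Pow J. \<Sum>\<tau>\<in>?\<Theta>. \<Sum>T\<in>supports. \<bar>?P (toggle \<tau> A T) \<tau> - ?P T \<tau>\<bar>)
        + (\<Sum>\<tau>\<in>?\<Theta>. \<Sum>T\<in>supports. few \<tau> T * (\<Sum>A\<in>Pow J. g \<tau> (toggle \<tau> A T)) * ?P T \<tau>)"
      by (simp add: sum.distrib sum_distrib_left sum_distrib_right sum.swap[of _ "Pow J"])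
    also have "\<dots> \<le> (\<Sum>A\<in>Pow J. real N * (n * \<eta>))
        + (\<Sum>\<tau>\<in>?\<Theta>. \<Sum>T\<in>supports. (2 ^ card J * (w / sqrt (real (N - M)))) * ?P T \<tau>)"
    proof (intro add_mono sum_mono mult_right_mono obs_prob_nonneg)
      fix A assume "A \<in> Pow J"
      then have A: "A \<subseteq> J" by simp
      then have "card A \<le> N" using card_mono[OF _ A] by simp
      then have "real (card A) * (n * \<eta>) \<le> real N * (n * \<eta>)"
        using n_pos \<eta>_nonneg by (intro mult_right_mono) auto
      then show "(\<Sum>\<tau>\<in>?\<Theta>. \<Sum>T\<in>supports. \<bar>?P (toggle \<tau> A T) \<tau> - ?P T \<tau>\<bar>) \<le> real N * (n * \<eta>)"
        using toggle_close[OF N A, of t d] unfolding n_def by linarith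
    next
      fix \<tau> T assume T: "T \<in> supports"
      then have finT: "finite T" using supports_iff[OF N] finite_subset by blast
      let ?F = "free_bits \<tau> T" and ?W = "{s \<in> {1..N}. good s (outcome_of t \<tau>)}"
      show "few \<tau> T * (\<Sum>A\<in>Pow J. g \<tau> (toggle \<tau> A T)) \<le> 2 ^ card J * (w / sqrt (real (N - M)))"
      proof (cases "card (J - ?F) < M")
        case True
        have "(\<Sum>A\<in>Pow J. g \<tau> (toggle \<tau> A T)) = real (card {A \<in> Pow J. good (card (toggle \<tau> A T)) (outcome_of t \<tau>)})"
          by (simp add: g_def of_bool_def sum.If_cases Int_def)
        also have "{A \<in> Pow J. good (card (toggle \<tau> A T)) (outcome_of t \<tau>)}
            \<subseteq> {A \<in> Pow J. card (sym_diff T (A \<inter> ?F)) \<in> ?W}"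
        proof safe
          fix A assume "A \<subseteq> J" and gd: "good (card (toggle \<tau> A T)) (outcome_of t \<tau>)"
          have "toggle \<tau> A T \<in> supports" by (rule toggle_supports[OF N T])
          then have "1 \<in> toggle \<tau> A T" "toggle \<tau> A T \<subseteq> {1..N}" using supports_iff[OF N] by blast+
          then have "card (toggle \<tau> A T) \<in> {1..N}"
            using card_mono[of "{1..N}" "toggle \<tau> A T"] finite_subset[of "toggle \<tau> A T" "{1..N}"]
            by (auto simp: Suc_le_eq card_gt_0_iff)
          then show "card (sym_diff T (A \<inter> ?F)) \<in> {1..N}" unfolding toggle_def .
          show "good (card (sym_diff T (A \<inter> ?F))) (outcome_of t \<tau>)" using gd unfolding toggle_def .
        qed
        then have "real (card {A \<in> Pow J. good (card (toggle \<tau> A T)) (outcome_of t \<tau>)})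
            \<le> real (card {A \<in> Pow J. card (sym_diff T (A \<inter> ?F)) \<in> ?W})"
          by (intro of_nat_mono card_mono) auto
        also have "\<dots> = 2 ^ card (J - ?F) * real (card {A \<in> Pow ?F. card (sym_diff T A) \<in> ?W})"
          using card_Pow_inter[of J ?F "\<lambda>A. card (sym_diff T A) \<in> ?W"] finite_free_bits by simp
        also have "\<dots> \<le> 2 ^ card (J - ?F) * (real (card ?W) * (2 ^ card ?F / sqrt (real (card ?F + 1))))"
          using card_sym_diff_window[OF finT finite_free_bits(1)[of \<tau> T], of ?W]
          by (intro mult_left_mono) auto
        also have "\<dots> = 2 ^ (card (J - ?F) + card ?F) * (real (card ?W) / sqrt (real (card ?F + 1)))"
          by (simp add: power_add)
        also have "card (J - ?F) + card ?F = card J"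
          using finite_free_bits[of \<tau> T] card_mono[OF _ finite_free_bits(2)[of \<tau> T]]
          by (simp add: card_Diff_subset)
        also have "2 ^ card J * (real (card ?W) / sqrt (real (card ?F + 1))) \<le> 2 ^ card J * (w / sqrt (real (N - M)))"
        proof -
          have "N - M \<le> card ?F + 1"
            using True \<open>card (J - ?F) + card ?F = card J\<close> by simp
          then have "sqrt (real (N - M)) \<le> sqrt (real (card ?F + 1))"
            by (simp only: real_sqrt_le_iff of_nat_le_iff)
          then show ?thesis using M win[of "outcome_of t \<tau>"] w_nonneg
            by (intro mult_left_mono frac_le) auto
        qed
        finally show ?thesis using True by (simp add: few_def)
      next
        case False
        then show ?thesis using w_nonneg by (simp add: few_def)
      qed
    qed
    also have "\<dots> = 2 ^ card J * (n * (real N * \<eta> + w / sqrt (real (N - M))))"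
    proof -
      have "(\<Sum>\<tau>\<in>?\<Theta>. \<Sum>T\<in>supports. ?P T \<tau>) = n"
        using sum_transcripts_1 supports_iff[OF N] by (subst sum.swap) (simp add: n_def)
      then have eq: "(\<Sum>\<tau>\<in>?\<Theta>. \<Sum>T\<in>supports. (2 ^ card J * (w / sqrt (real (N - M)))) * ?P T \<tau>)
          = (2 ^ card J * (w / sqrt (real (N - M)))) * n"
        by (simp only: sum_distrib_left[symmetric])
      show ?thesis unfolding eq by (simp add: card_Pow algebra_simps)
    qed
    finally show "?S \<le> n * (real N * \<eta> + w / sqrt (real (N - M)))" by simp
  qed
  also have "\<dots> = n * ((2 * real d + real N * \<eta>) / real M + real N * \<eta> + w / sqrt (real (N - M)))"
    by (simp add: algebra_simps)
  finally show ?thesis using n_pos by (simp add: n_def pos_divide_le_eq mult.commute)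
qed

end

subsection \<open>From conditional evaluation to sum queries\<close>

definition weighted_pmf :: "(nat \<Rightarrow> nat) \<Rightarrow> nat set \<Rightarrow> nat pmf" where
  "weighted_pmf \<omega> T = embed_pmf (\<lambda>k. if k \<in> T then real (\<omega> k) / real (wsum \<omega> T UNIV) else 0)"

context
  fixes \<omega> :: "nat \<Rightarrow> nat" and T :: "nat set"
  assumes T: "finite T" "T \<noteq> {}" and pos: "\<And>k. k \<in> T \<Longrightarrow> \<omega> k > 0"
begin

lemma wsum_UNIV_pos: "wsum \<omega> T UNIV > 0"
  using T pos by (auto simp: wsum_def intro!: sum_pos)

lemma pmf_weighted_pmf:
  "pmf (weighted_pmf \<omega> T) k = (if k \<in> T then real (\<omega> k) / real (wsum \<omega> T UNIV) else 0)"
  unfolding weighted_pmf_def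
proof (rule pmf_embed_pmf)
  have "(\<integral>\<^sup>+ k. ennreal (if k \<in> T then real (\<omega> k) / real (wsum \<omega> T UNIV) else 0) \<partial>count_space UNIV)
      = (\<Sum>k\<in>T. ennreal (if k \<in> T then real (\<omega> k) / real (wsum \<omega> T UNIV) else 0))"
    using T by (intro nn_integral_count_space') auto
  also have "\<dots> = ennreal (\<Sum>k\<in>T. real (\<omega> k) / real (wsum \<omega> T UNIV))"
    by (subst sum_ennreal[symmetric]) auto
  also have "(\<Sum>k\<in>T. real (\<omega> k) / real (wsum \<omega> T UNIV)) = 1"
    using wsum_UNIV_pos by (simp add: sum_divide_distrib[symmetric] wsum_def flip: of_nat_sum)
  finally show "(\<integral>\<^sup>+ k. ennreal (if k \<in> T then real (\<omega> k) / real (wsum \<omega> T UNIV) else 0)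
      \<partial>count_space UNIV) = 1" by simp
qed simp

lemma set_weighted_pmf: "set_pmf (weighted_pmf \<omega> T) = T"
  using wsum_UNIV_pos pos by (auto simp: set_pmf_iff pmf_weighted_pmf split: if_splits)

lemma measure_weighted_pmf:
  "measure_pmf.prob (weighted_pmf \<omega> T) S = real (wsum \<omega> T S) / real (wsum \<omega> T UNIV)"
proof -
  have "measure_pmf.prob (weighted_pmf \<omega> T) S = measure_pmf.prob (weighted_pmf \<omega> T) (S \<inter> T)"
    using measure_Int_set_pmf[of "weighted_pmf \<omega> T" S] by (simp add: set_weighted_pmf)
  also have "\<dots> = (\<Sum>k\<in>S \<inter> T. pmf (weighted_pmf \<omega> T) k)"
    using T by (intro measure_measure_pmf_finite) auto
  also have "\<dots> = (\<Sum>k\<in>S \<inter> T. real (\<omega> k) / real (wsum \<omega> T UNIV))"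
    by (intro sum.cong) (auto simp: pmf_weighted_pmf)
  finally show ?thesis by (simp add: sum_divide_distrib wsum_def)
qed

lemma cond_eval_weighted_pmf_None:
  "wsum \<omega> T S = 0 \<Longrightarrow> pmf (cond_eval (weighted_pmf \<omega> T) S) None = 1"
  by (simp add: cond_eval_def measure_weighted_pmf)

text \<open>A lower bound suffices, and it holds because the fibre of the response contains
  \<open>j\<close>.\<close>

lemma cond_eval_weighted_pmf_Some:
  assumes "wsum \<omega> T S > 0" "j \<in> S \<inter> T"
  shows "pmf (cond_eval (weighted_pmf \<omega> T) S)
      (Some (j, real (\<omega> j) / real (wsum \<omega> T UNIV), real (\<omega> j) / real (wsum \<omega> T S)))
    \<ge> real (\<omega> j) / real (wsum \<omega> T S)"
proof -
  let ?D = "weighted_pmf \<omega> T" and ?Z = "real (wsum \<omega> T UNIV)"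
  let ?f = "\<lambda>j. Some (j, pmf ?D j, pmf ?D j / measure_pmf.prob ?D S)"
  have Z: "?Z > 0" using wsum_UNIV_pos by simp
  have pos_S: "measure_pmf.prob ?D S > 0" using assms(1) Z by (simp add: measure_weighted_pmf)
  have ne: "set_pmf ?D \<inter> S \<noteq> {}" using assms(2) by (auto simp: set_weighted_pmf)
  have fj: "?f j = Some (j, real (\<omega> j) / ?Z, real (\<omega> j) / real (wsum \<omega> T S))"
    using assms Z by (simp add: pmf_weighted_pmf measure_weighted_pmf)
  have "real (\<omega> j) / real (wsum \<omega> T S) = pmf (cond_pmf ?D S) j"
    using assms Z by (simp add: pmf_cond[OF ne] pmf_weighted_pmf measure_weighted_pmf)
  also have "\<dots> \<le> measure_pmf.prob (cond_pmf ?D S) (?f -` {?f j})"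
    unfolding measure_pmf_single[symmetric] by (intro measure_pmf.finite_measure_mono) auto
  also have "\<dots> = pmf (map_pmf ?f (cond_pmf ?D S)) (?f j)" by (rule pmf_map[symmetric])
  also have "map_pmf ?f (cond_pmf ?D S) = cond_eval ?D S" using pos_S by (simp add: cond_eval_def)
  finally show ?thesis unfolding fj .
qed

end

section \<open>Following the most likely replies\<close>

primrec follow :: "(nat set \<Rightarrow> response) \<Rightarrow> strategy \<Rightarrow> real \<times> nat" where
  "follow r (Output s) = (s, 0)"
| "follow r (Query S k) = (fst (follow r (k (r S))), Suc (snd (follow r (k (r S)))))"

lemma measure_bind_pmf:
  "measure_pmf.prob (bind_pmf M f) X = (\<integral>x. measure_pmf.prob (f x) X \<partial>measure_pmf M)"
  unfolding measure_pmf_bind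
  by (subst measure_pmf.measure_bind[where N = "count_space UNIV"])
    (auto simp: space_subprob_algebra intro!: prob_space_imp_subprob_space measure_pmf.prob_space_axioms)

text \<open>Each query departs from the reply \<open>r\<close> with probability at most
  \<open>\<eta>\<close>. Only queries on the path of \<open>follow\<close> are charged, since the
  induction continues along the predicted reply alone.\<close>

lemma prob_run_le:
  assumes r: "\<And>S. pmf (cond_eval D S) (r S) \<ge> 1 - \<eta>"
  shows "measure_pmf.prob (run D t) {p. fst p \<in> X} \<le> of_bool (fst (follow r t) \<in> X) + \<eta> * real (snd (follow r t))"
proof (induction t)
  case (Output s)
  then show ?case by (simp add: measure_return_pmf indicator_def)
next
  case (Query S k)
  let ?\<phi> = "\<lambda>x. measure_pmf.prob (run D (k x)) {p. fst p \<in> X}"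
  have "measure_pmf.prob (map_pmf (\<lambda>(s, m). (s, Suc m)) (run D (k x))) {p. fst p \<in> X} = ?\<phi> x" for x
    unfolding measure_map_pmf by (rule arg_cong[where f = "measure_pmf.prob (run D (k x))"]) auto
  then have "measure_pmf.prob (run D (Query S k)) {p. fst p \<in> X} = (\<integral>x. ?\<phi> x \<partial>measure_pmf (cond_eval D S))"
    by (simp add: measure_bind_pmf)
  also have "\<dots> \<le> (\<integral>x. ?\<phi> (r S) + indicator (- {r S}) x \<partial>measure_pmf (cond_eval D S))"
  proof (rule integral_mono)
    show "integrable (measure_pmf (cond_eval D S)) ?\<phi>"
      by (rule measure_pmf.integrable_const_bound[where B = 1]) auto
    show "?\<phi> x \<le> ?\<phi> (r S) + indicator (- {r S}) x" for x
      by (cases "x = r S") (auto simp: add_increasing)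
    have "?\<phi> (r S) \<le> 2" by (rule order_trans[OF measure_pmf.prob_le_1]) simp
    then show "integrable (measure_pmf (cond_eval D S)) (\<lambda>x. ?\<phi> (r S) + indicator (- {r S}) x)"
      by (intro measure_pmf.integrable_const_bound[where B = 2] AE_I2) (auto simp: indicator_def)
  qed
  also have "\<dots> = ?\<phi> (r S) + measure_pmf.prob (cond_eval D S) (- {r S})"
  proof -
    have "integrable (measure_pmf (cond_eval D S)) (indicator (- {r S}) :: _ \<Rightarrow> real)"
      by (rule measure_pmf.integrable_const_bound[where B = 1]) (auto simp: indicator_def)
    then show ?thesis by (subst Bochner_Integration.integral_add) (auto simp: measure_pmf.prob_space)
  qed
  also have "measure_pmf.prob (cond_eval D S) (- {r S}) = 1 - pmf (cond_eval D S) (r S)"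
    using measure_pmf.prob_compl[of "{r S}" "cond_eval D S"] by (simp add: measure_pmf_single Compl_eq_Diff_UNIV)
  also have "?\<phi> (r S) + \<dots> \<le> of_bool (fst (follow r (k (r S))) \<in> X) + \<eta> * real (snd (follow r (k (r S)))) + \<eta>"
    using Query[OF rangeI, of "r S"] r[of S] by simp
  finally show ?case by (simp add: algebra_simps)
qed

text \<open>Transfers a query bound valid for all runs to the path followed under
  \<open>r\<close>.\<close>

lemma follow_in_run:
  assumes "\<And>S. pmf (cond_eval D S) (r S) > 0"
  shows "follow r t \<in> set_pmf (run D t)"
proof (induction t)
  case (Query S k)
  have "r S \<in> set_pmf (cond_eval D S)" using assms[of S] by (simp add: set_pmf_iff)
  moreover have "follow r (Query S k) \<in> (\<lambda>(s, m). (s, Suc m)) ` set_pmf (run D (k (r S)))"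
    using Query[OF rangeI, of "r S"] by (intro image_eqI[of _ _ "follow r (k (r S))"]) (auto simp: case_prod_beta)
  ultimately show ?case by auto
qed simp

text \<open>The sum \<open>v\<close> over \<open>S\<close> reveals the index \<open>lead v\<close> of its dominant weight, which is what the oracle
  returns with probability close to 1.\<close>

primrec sum_tree_of :: "(nat \<Rightarrow> nat) \<Rightarrow> nat \<Rightarrow> strategy \<Rightarrow> sum_tree" where
  "sum_tree_of lead z (Output s) = Leaf s"
| "sum_tree_of lead z (Query S k) = Ask S (\<lambda>v.
    if v = 0 then sum_tree_of lead z (k None)
    else Ask {lead v} (\<lambda>u. sum_tree_of lead z (k (Some (lead v, real u / real z, real u / real v)))))"

context masked_weights
begin

definition reply :: "nat set \<Rightarrow> (nat \<Rightarrow> nat) \<Rightarrow> nat set \<Rightarrow> response" where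
  "reply T \<omega> S = (let v = wsum \<omega> T S; j = lead v in
    if v = 0 then None
    else Some (j, real (\<omega> j) / real (wsum \<omega> T UNIV), real (\<omega> j) / real v))"

text \<open>An oracle call costs at most two sum questions: the sum \<open>v\<close> over
  \<open>S\<close> and, if it is positive, the singleton \<open>{lead v}\<close>, whose sum is the
  weight itself because \<open>lead v\<close> belongs to \<open>T\<close>.\<close>

lemma follow_reply:
  assumes "\<omega> \<in> \<Omega>" "T \<subseteq> {1..N}"
  shows "outcome (wsum \<omega> T) (sum_tree_of lead (wsum \<omega> T UNIV) t) = fst (follow (reply T \<omega>) t) \<and>
    length (trace (wsum \<omega> T) (sum_tree_of lead (wsum \<omega> T UNIV) t)) \<le> 2 * snd (follow (reply T \<omega>) t)"
proof (induction t)
  case (Query S k)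
  show ?case
  proof (cases "wsum \<omega> T S = 0")
    case True
    then have "reply T \<omega> S = None" by (simp add: reply_def)
    then show ?thesis using Query[OF rangeI, of None] True by auto
  next
    case False
    let ?j = "lead (wsum \<omega> T S)"
    have "?j \<in> T" using lead_in[OF assms] False by simp
    then have wj: "wsum \<omega> T {?j} = \<omega> ?j" by (simp add: wsum_def)
    let ?r = "Some (?j, real (\<omega> ?j) / real (wsum \<omega> T UNIV), real (\<omega> ?j) / real (wsum \<omega> T S))"
    have "reply T \<omega> S = ?r" using False by (simp add: reply_def Let_def)
    then show ?thesis using Query[OF rangeI, of ?r] False wj by auto
  qed
qed simp

lemma cond_eval_reply:
  assumes \<omega>: "\<omega> \<in> \<Omega>" and T: "T \<subseteq> {1..N}" "T \<noteq> {}" and \<eta>: "0 \<le> \<eta>"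
  shows "pmf (cond_eval (weighted_pmf \<omega> T) S) (reply T \<omega> S) \<ge> 1 - \<eta>"
proof -
  have fin: "finite T" using T finite_subset by blast
  have pos: "\<And>k. k \<in> T \<Longrightarrow> \<omega> k > 0" using weight_pos[OF \<omega>] T by blast
  show ?thesis
  proof (cases "wsum \<omega> T S = 0")
    case True
    then show ?thesis
      using cond_eval_weighted_pmf_None[OF fin T(2) pos True] \<eta> by (simp add: reply_def)
  next
    case False
    then have v: "wsum \<omega> T S > 0" by simp
    have "1 - \<eta> \<le> real (\<omega> (lead (wsum \<omega> T S))) / real (wsum \<omega> T S)"
      using lead_dominates[OF \<omega> T(1) v] v by (simp add: field_simps)
    also have "\<dots> \<le> pmf (cond_eval (weighted_pmf \<omega> T) S) (reply T \<omega> S)"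
      using cond_eval_weighted_pmf_Some[OF fin T(2) pos v lead_in[OF \<omega> T(1) v]] v
      by (simp add: reply_def Let_def)
    finally show ?thesis .
  qed
qed

end

section \<open>Passing to a deterministic algorithm by averaging\<close>

lemma within_factor_sets: "{s. within_factor \<epsilon> x s} \<in> sets borel"
proof -
  have "{s. within_factor \<epsilon> x s} = {x / (1 + \<epsilon>)..(1 + \<epsilon>) * x}"
    by (auto simp: within_factor_def)
  then show ?thesis by simp
qed

text \<open>The easy direction of Yao's principle, by averaging over strategies. The gap between
  \<open>2 / 3\<close> and \<open>3 / 5\<close> spares strict inequalities between integrals;
  strategies violating the query bound form a null set and can be avoided.\<close>

lemma yao:
  assumes rand: "randomized_algorithm n A" and appr: "approximates_support_size n \<epsilon> A"
    and queries: "makes_at_most_queries n q A"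
    and I: "finite I" "I \<noteq> {}" and D: "\<And>i. i \<in> I \<Longrightarrow> D i \<in> distributions n"
  shows "\<exists>t. (\<forall>i\<in>I. \<forall>(s, m)\<in>set_pmf (run (D i) t). m \<le> q) \<and>
    3 / 5 * real (card I) \<le>
      (\<Sum>i\<in>I. measure_pmf.prob (run (D i) t) {p. fst p \<in> {s. within_factor \<epsilon> (real (card (set_pmf (D i)))) s}})"
proof -
  interpret A: prob_space A using rand by (simp add: randomized_algorithm_def)
  define X where "X i = {s. within_factor \<epsilon> (real (card (set_pmf (D i)))) s}" for i
  have X: "X i \<in> sets borel" for i unfolding X_def by (rule within_factor_sets)
  have est: "estimate_distr (D i) \<in> measurable A (subprob_algebra borel)" if "i \<in> I" for i
    using rand D[OF that] by (simp add: randomized_algorithm_def)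
  define f where "f i t = measure_pmf.prob (run (D i) t) {p. fst p \<in> X i}" for i t
  have f: "f i t = measure (estimate_distr (D i) t) (X i)" for i t
    unfolding f_def estimate_distr_def using X[of i]
    by (subst measure_distr) (auto simp: vimage_def)
  have integrable: "integrable A (f i)" if "i \<in> I" for i
  proof (rule A.integrable_const_bound[where B = 1])
    show "f i \<in> borel_measurable A"
      unfolding f by (rule measurable_compose[OF est[OF that] measurable_measure_subprob_algebra[OF X]])
  qed (auto simp: f_def)
  have "2 / 3 \<le> (\<integral>t. f i t \<partial>A)" if "i \<in> I" for i
  proof -
    have "2 / 3 \<le> measure (output_distr A (D i)) (X i)"
      using appr D[OF that] by (simp add: approximates_support_size_def X_def)
    also have "\<dots> = (\<integral>t. f i t \<partial>A)"
      unfolding output_distr_def f by (rule A.measure_bind[OF est[OF that] X])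
    finally show ?thesis .
  qed
  then have "(\<Sum>i\<in>I. 2 / 3) \<le> (\<Sum>i\<in>I. \<integral>t. f i t \<partial>A)" by (intro sum_mono)
  also have "\<dots> = (\<integral>t. (\<Sum>i\<in>I. f i t) \<partial>A)"
    using integrable by (subst Bochner_Integration.integral_sum) auto
  finally have large: "2 / 3 * real (card I) \<le> (\<integral>t. (\<Sum>i\<in>I. f i t) \<partial>A)" by simp
  have ae: "AE t in A. \<forall>i\<in>I. \<forall>(s, m)\<in>set_pmf (run (D i) t). m \<le> q"
    using queries D I(1) by (intro AE_finite_allI) (auto simp: makes_at_most_queries_def)
  show ?thesis
  proof (rule ccontr)
    assume "\<not> ?thesis"
    then have no: "\<And>t. (\<forall>i\<in>I. \<forall>(s, m)\<in>set_pmf (run (D i) t). m \<le> q) \<Longrightarrow>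
        (\<Sum>i\<in>I. f i t) < 3 / 5 * real (card I)"
      unfolding f_def X_def by (meson not_le)
    have "(\<integral>t. (\<Sum>i\<in>I. f i t) \<partial>A) \<le> 3 / 5 * real (card I)"
    proof (rule A.integral_le_const)
      show "integrable A (\<lambda>t. \<Sum>i\<in>I. f i t)" using integrable by auto
      show "AE t in A. (\<Sum>i\<in>I. f i t) \<le> 3 / 5 * real (card I)"
        using ae by eventually_elim (use no in fastforce)
    qed
    moreover have "card I > 0" using I by (simp add: card_gt_0_iff)
    ultimately show False using large by simp
  qed
qed

lemma (in masked_weights) deterministic_sum_tree:
  assumes rand: "randomized_algorithm n A" and appr: "approximates_support_size n \<epsilon> A"
    and queries: "makes_at_most_queries n q A" and "N \<le> n" and \<eta>: "0 \<le> \<eta>" "\<eta> < 1"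
    and \<S>: "finite \<S>" "\<S> \<noteq> {}" "\<And>T. T \<in> \<S> \<Longrightarrow> T \<subseteq> {1..N} \<and> T \<noteq> {}"
  shows "\<exists>t. (\<forall>T\<in>\<S>. \<forall>\<omega>\<in>\<Omega>. length (trace (wsum \<omega> T) t) \<le> 2 * q + 1) \<and>
    (3 / 5 - \<eta> * real q) * real (card \<S>)
      \<le> (\<Sum>T\<in>\<S>. average (\<lambda>\<omega>. of_bool (within_factor \<epsilon> (real (card T)) (outcome (wsum \<omega> T) t))))"
proof -
  define D where "D = (\<lambda>(T, \<omega>). weighted_pmf \<omega> T)"
  have fin: "finite T" if "T \<in> \<S>" for T using \<S>(3)[OF that] finite_subset by blast
  have set_D: "set_pmf (D (T, \<omega>)) = T" if "T \<in> \<S>" "\<omega> \<in> \<Omega>" for T \<omega>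
    unfolding D_def using \<S>(3)[OF that(1)] weight_pos[OF that(2)] fin[OF that(1)]
    by (auto simp: set_weighted_pmf subset_iff)
  have "D i \<in> distributions n" if i: "i \<in> \<S> \<times> \<Omega>" for i
  proof -
    obtain T \<omega> where [simp]: "i = (T, \<omega>)" by (cases i)
    have "T \<subseteq> {1..N}" using \<S>(3) i by auto
    then have "T \<subseteq> {1..n}" using \<open>N \<le> n\<close> by fastforce
    then show ?thesis using set_D[of T \<omega>] i by (simp add: distributions_def)
  qed
  moreover have "finite (\<S> \<times> \<Omega>)" "\<S> \<times> \<Omega> \<noteq> {}"
    using \<S>(1,2) finite_\<Omega> \<Omega>_nonempty by auto
  ultimately have "\<exists>t. (\<forall>i\<in>\<S> \<times> \<Omega>. \<forall>(s, m)\<in>set_pmf (run (D i) t). m \<le> q) \<and>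
    3 / 5 * real (card (\<S> \<times> \<Omega>)) \<le> (\<Sum>i\<in>\<S> \<times> \<Omega>.
      measure_pmf.prob (run (D i) t) {p. fst p \<in> {s. within_factor \<epsilon> (real (card (set_pmf (D i)))) s}})"
    by (intro yao[OF rand appr queries])
  then obtain t where
    t': "\<forall>i\<in>\<S> \<times> \<Omega>. \<forall>(s, m)\<in>set_pmf (run (D i) t). m \<le> q"
    and succ: "3 / 5 * real (card (\<S> \<times> \<Omega>)) \<le> (\<Sum>i\<in>\<S> \<times> \<Omega>.
      measure_pmf.prob (run (D i) t) {p. fst p \<in> {s. within_factor \<epsilon> (real (card (set_pmf (D i)))) s}})"
    by blast
  have t: "m \<le> q" if "T \<in> \<S>" "\<omega> \<in> \<Omega>" "(s, m) \<in> set_pmf (run (D (T, \<omega>)) t)" for T \<omega> s m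
    using bspec[OF bspec[OF t', of "(T, \<omega>)"] that(3)] that(1,2) by simp
  \<comment> \<open>The opening question about \<open>UNIV\<close> supplies the normalising constant
    contained in the replies; it accounts for the \<open>+ 1\<close>.\<close>
  define t' where "t' = Ask UNIV (\<lambda>z. sum_tree_of lead z t)"
  have reply: "pmf (cond_eval (D (T, \<omega>)) S) (reply T \<omega> S) \<ge> 1 - \<eta>" if "T \<in> \<S>" "\<omega> \<in> \<Omega>" for T \<omega> S
    unfolding D_def using cond_eval_reply[OF that(2)] \<S>(3)[OF that(1)] \<eta> by simp
  have count: "snd (follow (reply T \<omega>) t) \<le> q" if i: "T \<in> \<S>" "\<omega> \<in> \<Omega>" for T \<omega>
  proof -
    have "pmf (cond_eval (D (T, \<omega>)) S) (reply T \<omega> S) > 0" for S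
      using reply[OF i, of S] \<eta> by linarith
    from follow_in_run[OF this, of t] show ?thesis using t[OF i] by (metis prod.collapse)
  qed
  have trace: "outcome (wsum \<omega> T) t' = fst (follow (reply T \<omega>) t)"
    "length (trace (wsum \<omega> T) t') \<le> 2 * q + 1" if i: "T \<in> \<S>" "\<omega> \<in> \<Omega>" for T \<omega>
    using follow_reply[OF i(2), of T t] \<S>(3)[OF i(1)] count[OF i] by (auto simp: t'_def)
  let ?b = "\<lambda>T \<omega>. of_bool (within_factor \<epsilon> (real (card T)) (outcome (wsum \<omega> T) t')) :: real"
  have "3 / 5 * real (card (\<S> \<times> \<Omega>)) \<le> (\<Sum>(T, \<omega>)\<in>\<S> \<times> \<Omega>. ?b T \<omega> + \<eta> * real q)"
  proof (rule order_trans[OF succ], rule sum_mono)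
    fix i assume "i \<in> \<S> \<times> \<Omega>"
    then obtain T \<omega> where [simp]: "i = (T, \<omega>)" and i: "T \<in> \<S>" "\<omega> \<in> \<Omega>" by auto
    have "measure_pmf.prob (run (D i) t) {p. fst p \<in> {s. within_factor \<epsilon> (real (card (set_pmf (D i)))) s}}
        \<le> ?b T \<omega> + \<eta> * real (snd (follow (reply T \<omega>) t))"
      using prob_run_le[OF reply[OF i], of t "{s. within_factor \<epsilon> (real (card T)) s}"]
      by (simp add: set_D[OF i] trace(1)[OF i])
    also have "\<dots> \<le> ?b T \<omega> + \<eta> * real q"
      using count[OF i] \<eta> by (simp add: mult_left_mono)
    finally show "measure_pmf.prob (run (D i) t) {p. fst p \<in> {s. within_factor \<epsilon> (real (card (set_pmf (D i)))) s}}
        \<le> (case i of (T, \<omega>) \<Rightarrow> ?b T \<omega> + \<eta> * real q)" by simp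
  qed
  also have "\<dots> = (\<Sum>T\<in>\<S>. \<Sum>\<omega>\<in>\<Omega>. ?b T \<omega>) + real (card (\<S> \<times> \<Omega>)) * (\<eta> * real q)"
    by (simp add: sum.cartesian_product[symmetric] sum.distrib card_cartesian_product)
  also have "(\<Sum>T\<in>\<S>. \<Sum>\<omega>\<in>\<Omega>. ?b T \<omega>) = real (card \<Omega>) * (\<Sum>T\<in>\<S>. average (?b T))"
    using card_\<Omega>_pos by (simp add: average_def sum_divide_distrib[symmetric])
  finally have "real (card \<Omega>) * ((3 / 5 - \<eta> * real q) * real (card \<S>)) \<le> real (card \<Omega>) * (\<Sum>T\<in>\<S>. average (?b T))"
    by (simp add: card_cartesian_product algebra_simps)
  then have "(3 / 5 - \<eta> * real q) * real (card \<S>) \<le> (\<Sum>T\<in>\<S>. average (?b T))"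
    using card_\<Omega>_pos by (simp only: mult_le_cancel_left_pos)
  then show ?thesis using trace(2) by blast
qed

subsection \<open>The query lower bounds\<close>

lemma within_factor_ratio:
  assumes "0 < \<epsilon>" "within_factor \<epsilon> (real s) x" "within_factor \<epsilon> (real s') x"
  shows "real s' \<le> (1 + \<epsilon>)\<^sup>2 * real s"
proof -
  have "real s' \<le> (1 + \<epsilon>) * x" using assms by (simp add: within_factor_def field_simps)
  also have "\<dots> \<le> (1 + \<epsilon>) * ((1 + \<epsilon>) * real s)"
    using assms by (intro mult_left_mono) (auto simp: within_factor_def)
  finally show ?thesis by (simp add: power2_eq_square)
qed

text \<open>Sizes compatible with one estimate differ by a factor of at most
  \<open>(1 + \<epsilon>)\<^sup>2 \<le> 1 + 3 * \<epsilon>\<close>, hence lie in an interval of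
  length at most \<open>3 * \<epsilon> * N\<close>.\<close>

lemma card_within_factor:
  assumes \<epsilon>: "0 < \<epsilon>" "\<epsilon> \<le> 1"
  shows "real (card {s \<in> {1..N}. within_factor \<epsilon> (real s) x}) \<le> 3 * \<epsilon> * real N + 1"
proof (cases "{s \<in> {1..N}. within_factor \<epsilon> (real s) x} = {}")
  case True
  then show ?thesis using \<epsilon> by (metis add_nonneg_nonneg card.empty mult_nonneg_nonneg of_nat_0 of_nat_0_le_iff
    less_imp_le zero_le_numeral zero_le_one)
next
  case False
  let ?W = "{s \<in> {1..N}. within_factor \<epsilon> (real s) x}"
  define a where "a = Min ?W"
  define b where "b = Max ?W"
  have a: "a \<in> ?W" unfolding a_def using False by (intro Min_in) auto
  have b: "b \<in> ?W" unfolding b_def using False by (intro Max_in) auto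
  have "?W \<subseteq> {a..b}"
  proof
    fix s assume "s \<in> ?W"
    then show "s \<in> {a..b}" unfolding a_def b_def by (auto intro!: Min_le Max_ge)
  qed
  then have "card ?W \<le> card {a..b}" by (intro card_mono) auto
  also have "\<dots> = Suc b - a" by simp
  finally have "real (card ?W) \<le> real b - real a + 1"
    using \<open>?W \<subseteq> {a..b}\<close> a by (auto simp: of_nat_diff)
  moreover have "real b \<le> (1 + \<epsilon>)\<^sup>2 * real a" using within_factor_ratio[of \<epsilon> a x b] a b \<epsilon> by simp
  moreover have "(1 + \<epsilon>)\<^sup>2 \<le> 1 + 3 * \<epsilon>"
    using \<epsilon> mult_left_mono[of \<epsilon> 1 \<epsilon>] by (simp add: power2_eq_square algebra_simps)
  ultimately have "real (card ?W) \<le> (1 + 3 * \<epsilon>) * real a - real a + 1"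
    by (smt (verit) mult_right_mono of_nat_0_le_iff)
  also have "\<dots> = 3 * \<epsilon> * real a + 1" by (simp add: algebra_simps)
  also have "\<dots> \<le> 3 * \<epsilon> * real N + 1" using a \<epsilon> by (simp add: mult_left_mono)
  finally show ?thesis .
qed

text \<open>The sizes are powers of 4 because \<open>(1 + \<epsilon>)\<^sup>2 < 4\<close>, so no
  estimate serves two of them. Their success probabilities sum to at least \<open>L / 2\<close>, yet
  to at most \<open>(2 * q + 3)!\<close>.\<close>

lemma queries_lower_bound_log:
  assumes alg: "randomized_algorithm n A" "approximates_support_size n \<epsilon> A" "makes_at_most_queries n q A"
    and \<epsilon>: "0 < \<epsilon>" "\<epsilon> < 1" and L: "4 ^ L \<le> n" "L > 0"
  shows "real L \<le> 2 * fact (2 * q + 3)"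
proof -
  define \<eta> where "\<eta> = 1 / (10 * (real n + real q + 1))"
  have \<eta>: "0 < \<eta>" "\<eta> < 1" "real n * \<eta> \<le> 1" "\<eta> * real q \<le> 1 / 10"
    by (auto simp: \<eta>_def field_simps)
  obtain \<Omega> lead where "masked_weights n \<eta> \<Omega> lead" using masked_weights_exist[OF \<eta>(1)] by blast
  then interpret masked_weights n \<eta> \<Omega> lead .
  have n: "n \<ge> 1" using L(1) by (metis One_nat_def Suc_leI le_trans nat_zero_less_power_iff zero_less_numeral)
  define B where "B = (\<lambda>l. 4 ^ l :: nat) ` {..<L}"
  have B: "B \<subseteq> {1..n}"
  proof
    fix s assume "s \<in> B"
    then obtain l where l: "s = 4 ^ l" "l < L" by (auto simp: B_def)
    have "(4::nat) ^ l \<le> 4 ^ L" using l(2) by (intro power_increasing) auto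
    then show "s \<in> {1..n}" using l(1) order_trans[OF _ L(1)] by simp
  qed
  have card_B: "card B = L" unfolding B_def by (subst card_image) (auto simp: inj_on_def)
  have finB: "finite B" by (simp add: B_def)
  have inj: "inj_on (\<lambda>s. {1..s}) B"
    by (rule inj_onI) (metis One_nat_def card_atLeastAtMost diff_Suc_1)
  let ?\<S> = "(\<lambda>s. {1..s}) ` B"
  have T: "T \<subseteq> {1..n} \<and> T \<noteq> {}" if mem: "T \<in> ?\<S>" for T
  proof -
    obtain s where s: "s \<in> B" "T = {1..s}" using mem by blast
    then have "s \<in> {1..n}" using B by blast
    then show ?thesis using s(2) by auto
  qed
  have fin_ne: "finite ?\<S>" "?\<S> \<noteq> {}" using finB card_B L(2) by auto
  obtain t where len: "\<forall>T\<in>?\<S>. \<forall>\<omega>\<in>\<Omega>. length (trace (wsum \<omega> T) t) \<le> 2 * q + 1"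
    and succ: "(3 / 5 - \<eta> * real q) * real (card ?\<S>)
      \<le> (\<Sum>T\<in>?\<S>. average (\<lambda>\<omega>. of_bool (within_factor \<epsilon> (real (card T)) (outcome (wsum \<omega> T) t))))"
    using deterministic_sum_tree[OF alg order_refl less_imp_le[OF \<eta>(1)] \<eta>(2) fin_ne T] by blast
  have "real L / 2 \<le> (3 / 5 - \<eta> * real q) * real (card ?\<S>)"
    using \<eta>(4) mult_right_mono[of "1 / 2" "3 / 5 - \<eta> * real q" "real L"]
    by (simp add: card_image[OF inj] card_B del: One_nat_def)
  also have "\<dots> \<le> (\<Sum>s\<in>B. average (\<lambda>\<omega>. of_bool (within_factor \<epsilon> (real s) (outcome (wsum \<omega> {1..s}) t))))"
    using succ unfolding sum.reindex[OF inj] by (simp add: o_def)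
  also have "\<dots> \<le> fact (2 * q + 1 + 2)"
  proof (rule initial_segment_success[OF n \<eta>(3) _ B])
    fix s \<omega> assume "s \<in> B" "\<omega> \<in> \<Omega>"
    then show "length (trace (wsum \<omega> {1..s}) t) \<le> 2 * q + 1" using len by blast
  next
    have less4: "(1 + \<epsilon>)\<^sup>2 < 4"
      using power_strict_mono[of "1 + \<epsilon>" 2 2] \<epsilon> by simp
    have le: "l \<le> l'" if "within_factor \<epsilon> (real (4 ^ l)) x" "within_factor \<epsilon> (real (4 ^ l')) x" for l l' x
    proof (rule ccontr)
      assume "\<not> l \<le> l'"
      then have "(4::real) ^ Suc l' \<le> 4 ^ l" by (intro power_increasing) auto
      also have "\<dots> \<le> (1 + \<epsilon>)\<^sup>2 * 4 ^ l'"
        using within_factor_ratio[OF \<epsilon>(1) that(2,1)] by simp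
      also have "\<dots> < 4 * 4 ^ l'" using less4 by simp
      finally show False by simp
    qed
    fix s s' x assume "s \<in> B" "s' \<in> B" and w: "within_factor \<epsilon> (real s) x" "within_factor \<epsilon> (real s') x"
    then obtain l l' where ll': "s = 4 ^ l" "s' = 4 ^ l'" by (auto simp: B_def)
    have "l = l'" using le w unfolding ll' by (intro order_antisym) blast+
    then show "s = s'" using ll' by simp
  qed
  finally show ?thesis by (simp add: numeral_3_eq_3)
qed

lemma ln_ln_ln_le:
  assumes n: "n \<ge> 4 ^ 13" and L: "\<And>L. \<lbrakk>4 ^ L \<le> n; L > 0\<rbrakk> \<Longrightarrow> real L \<le> 2 * fact (2 * q + 3)"
  shows "q \<ge> 1" "ln (ln (ln (real n))) \<le> 10 * real q"
proof -
  \<comment> \<open>\<open>4 ^ 13 \<le> n\<close> admits \<open>L = 13\<close>, whereas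
    \<open>q = 0\<close> would force \<open>L \<le> 2 * fact 3 = 12\<close>. The bound
    \<open>q \<ge> 1\<close> later absorbs additive constants.\<close>
  show q: "q \<ge> 1"
  proof (rule ccontr)
    assume "\<not> q \<ge> 1"
    then have "q = 0" by simp
    then have "(13::real) \<le> 2 * fact 3" using L[of 13] n by simp
    then show False by (simp add: fact_numeral)
  qed
  define m where "m = 2 * q + 3"
  obtain L' where L': "4 ^ L' \<le> n" "n < 4 ^ Suc L'"
    using ex_power_ivl1[of 4 n] n by fastforce
  have "L' > 0"
  proof (rule ccontr)
    assume "\<not> L' > 0"
    then have "n < 4" using L'(2) by simp
    then show False using n by simp
  qed
  have m: "real m \<ge> 5" using q by (simp add: m_def)
  have fact_le: "(fact m :: real) \<le> real m ^ m" using fact_le_power[of m, where ?'a = real] by simp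
  have ln4: "ln 4 \<le> (2::real)"
  proof -
    have "exp 1 \<ge> (2::real)" using exp_ge_add_one_self[of 1] by simp
    then have "exp 1 * exp 1 \<ge> 2 * (2::real)" by (intro mult_mono) auto
    then have "exp 2 \<ge> (4::real)" by (simp flip: exp_add)
    then show ?thesis by (metis exp_gt_zero ln_exp ln_mono zero_less_numeral)
  qed
  have ln_n: "ln (real n) > 1"
  proof -
    have "exp 1 < (4::real)" using exp_le by simp
    also have "4 \<le> real n" using n by simp
    finally have "exp 1 < exp (ln (real n))" using n by simp
    then show ?thesis by (simp only: exp_less_cancel_iff)
  qed
  have "real n \<le> 4 ^ Suc L'" using L'(2) by (metis less_imp_le of_nat_le_iff of_nat_numeral of_nat_power)
  then have "ln (real n) \<le> ln (4 ^ Suc L')" using n by (intro ln_mono) auto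
  also have "\<dots> = real (Suc L') * ln 4" by (simp only: ln_realpow zero_less_numeral)
  also have "\<dots> \<le> real (Suc L') * 2" using ln4 by (intro mult_left_mono) auto
  also have "\<dots> \<le> 6 * real m ^ m"
  proof -
    have "real L' \<le> 2 * fact m" unfolding m_def by (rule L[OF L'(1) \<open>L' > 0\<close>])
    moreover have "(1::real) \<le> fact m" by simp
    moreover have "(1 + a) * 2 \<le> 6 * p" if "a \<le> 2 * f" "1 \<le> f" "f \<le> p" for a f p :: real
      using that by simp
    ultimately show ?thesis using fact_le unfolding of_nat_Suc by blast
  qed
  finally have 1: "ln (real n) \<le> 6 * real m ^ m" .
  have "ln (ln (real n)) \<le> ln (6 * real m ^ m)" using 1 ln_n by (intro ln_mono) auto
  also have "\<dots> = ln 6 + real m * ln (real m)" using m by (simp add: ln_mult ln_realpow)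
  also have "\<dots> \<le> 6 + real m * real m"
    using m ln_le_minus_one[of 6] ln_le_minus_one[of "real m"] by (intro add_mono mult_left_mono) auto
  also have "\<dots> \<le> exp (2 * real m)"
  proof -
    have "1 + real m \<le> exp (real m)" by (rule exp_ge_add_one_self)
    then have "(1 + real m) * (1 + real m) \<le> exp (real m) * exp (real m)"
      using m by (intro mult_mono) auto
    then show ?thesis using m by (simp add: exp_add[symmetric] algebra_simps)
  qed
  finally have 2: "ln (ln (real n)) \<le> exp (2 * real m)" .
  have "ln (ln (ln (real n))) \<le> ln (exp (2 * real m))"
    using 2 ln_n by (intro ln_mono) auto
  also have "\<dots> = 4 * real q + 6" by (simp add: m_def)
  also have "\<dots> \<le> 10 * real q" using q by simp
  finally show "ln (ln (ln (real n))) \<le> 10 * real q" .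
qed

lemma queries_lower_bound_eps:
  assumes alg: "randomized_algorithm n A" "approximates_support_size n \<epsilon> A" "makes_at_most_queries n q A"
    and \<epsilon>: "0 < \<epsilon>" "\<epsilon> \<le> 1 / 1000" and n: "1 / \<epsilon>\<^sup>2 \<le> real n"
  shows "real q \<ge> 1 / (2000000 * \<epsilon>\<^sup>2)"
proof -
  \<comment> \<open>With \<open>N\<close> about \<open>1 / (10000 * \<epsilon>\<^sup>2)\<close>, the
    window of about \<open>3 * \<epsilon> * N\<close> sizes is short compared with the deviation of
    order \<open>sqrt N\<close> of a random support size.\<close>
  define y where "y = 1 / (10000 * \<epsilon>\<^sup>2)"
  have \<epsilon>2: "\<epsilon>\<^sup>2 \<le> 1 / 1000000" using power_mono[of \<epsilon> "1 / 1000" 2] \<epsilon> by (simp add: power2_eq_square)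
  have \<epsilon>2_pos: "\<epsilon>\<^sup>2 > 0" using \<epsilon> by simp
  have y: "y \<ge> 100" using \<epsilon>2 \<epsilon>2_pos by (simp add: y_def field_simps)
  define N where "N = nat \<lfloor>y\<rfloor>"
  have N: "real N \<le> y" "y < real N + 1" "N \<ge> 100"
    using y by (auto simp: N_def le_nat_iff le_floor_iff)
  have "y \<le> 1 / \<epsilon>\<^sup>2" using \<epsilon>2_pos by (simp add: y_def field_simps)
  then have Nn: "N \<le> n" using N(1) n by linarith
  have \<epsilon>N: "\<epsilon> * sqrt (real N) \<le> 1 / 100"
  proof -
    have "\<epsilon>\<^sup>2 * real N \<le> \<epsilon>\<^sup>2 * y" using N(1) by (intro mult_left_mono) auto
    also have "\<dots> = (1 / 100)\<^sup>2" using \<epsilon> by (simp add: y_def power2_eq_square)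
    finally have "sqrt (\<epsilon>\<^sup>2 * real N) \<le> sqrt ((1 / 100)\<^sup>2)" by (rule real_sqrt_le_mono)
    then show ?thesis using \<epsilon> by (simp add: real_sqrt_mult)
  qed
  have "real q > real N / 100"
  proof (rule ccontr)
    assume "\<not> real q > real N / 100"
    then have q: "real q \<le> real N / 100" by simp
    define \<eta> where "\<eta> = 1 / (100 * (real N + real q + 1))"
    have \<eta>: "0 < \<eta>" "\<eta> < 1" "real N * \<eta> \<le> 1 / 100" "\<eta> * real q \<le> 1 / 100"
      by (auto simp: \<eta>_def field_simps)
    obtain \<Omega> lead where "masked_weights N \<eta> \<Omega> lead" using masked_weights_exist[OF \<eta>(1)] by blast
    then interpret masked_weights N \<eta> \<Omega> lead .
    have N1: "N \<ge> 1" using N(3) by simp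
    have ne: "supports \<noteq> {}" by (auto simp: supports_def)
    have T: "T \<subseteq> {1..N} \<and> T \<noteq> {}" if "T \<in> supports" for T
      using that supports_iff[OF N1, of T] by blast
    obtain t where len: "\<forall>T\<in>supports. \<forall>\<omega>\<in>\<Omega>. length (trace (wsum \<omega> T) t) \<le> 2 * q + 1"
      and succ: "(3 / 5 - \<eta> * real q) * real (card supports)
        \<le> (\<Sum>T\<in>supports. average (\<lambda>\<omega>. of_bool (within_factor \<epsilon> (real (card T)) (outcome (wsum \<omega> T) t))))"
      using deterministic_sum_tree[OF alg Nn less_imp_le[OF \<eta>(1)] \<eta>(2) finite_supports ne T] by blast
    define M where "M = N div 2"
    have M: "0 < M" "M < N" "real M \<ge> real N / 2 - 1 / 2" "real (N - M) \<ge> real N / 2"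
      using N(3) by (auto simp: M_def)
    have card_pos: "real (card supports) > 0" by (simp add: card_supports)
    have "3 / 5 - \<eta> * real q \<le>
        (\<Sum>T\<in>supports. average (\<lambda>\<omega>. of_bool (within_factor \<epsilon> (real (card T)) (outcome (wsum \<omega> T) t))))
          / real (card supports)"
      using succ card_pos by (simp add: pos_le_divide_eq)
    also have "\<dots> \<le> (2 * real (2 * q + 1) + real N * \<eta>) / real M + real N * \<eta>
        + (3 * \<epsilon> * real N + 1) / sqrt (real (N - M))"
      using len \<epsilon> by (intro random_support_success[OF N1 M(1,2)] card_within_factor) auto
    finally have main: "3 / 5 - \<eta> * real q \<le> (2 * real (2 * q + 1) + real N * \<eta>) / real M + real N * \<eta>
        + (3 * \<epsilon> * real N + 1) / sqrt (real (N - M))" .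
    \<comment> \<open>The error budget: the three terms are at most \<open>1 / 5\<close>,
      \<open>1 / 100\<close> and \<open>13 / 50\<close>, together less than
      \<open>3 / 5 - 1 / 100\<close>.\<close>
    have "(2 * real (2 * q + 1) + real N * \<eta>) / real M \<le> 1 / 5"
      using q \<eta>(3) M(1,3) N(3) by (simp add: divide_le_eq)
    moreover have "(3 * \<epsilon> * real N + 1) / sqrt (real (N - M)) \<le> 13 / 50"
    proof -
      define r where "r = sqrt (real N)"
      have r: "r * r = real N" "r \<ge> 10"
      proof -
        have "sqrt 100 \<le> sqrt (real N)" using N(3) by (intro real_sqrt_le_mono) simp
        then show "r \<ge> 10" by (simp add: r_def)
      qed (simp add: r_def)
      have "3 * (\<epsilon> * r) * r \<le> 3 * (1 / 100) * r"
        using \<epsilon>N r by (intro mult_right_mono) (auto simp: r_def)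
      then have "3 * \<epsilon> * real N + 1 \<le> 13 / 100 * r" 
      proof -
        have "3 * \<epsilon> * real N = 3 * (\<epsilon> * r) * r" unfolding r(1)[symmetric] by simp
        with \<open>3 * (\<epsilon> * r) * r \<le> 3 * (1 / 100) * r\<close> show ?thesis using r(2) by linarith
      qed
      moreover have "r / 2 \<le> sqrt (real (N - M))"
      proof -
        have "(r / 2)\<^sup>2 \<le> real (N - M)" using M(4) r(1) by (simp add: power2_eq_square)
        then show ?thesis by (rule real_le_rsqrt)
      qed
      ultimately have "(3 * \<epsilon> * real N + 1) / sqrt (real (N - M)) \<le> (13 / 100 * r) / (r / 2)"
        using r by (intro frac_le) auto
      also have "\<dots> = 13 / 50" using r by simp
      finally show ?thesis .
    qed
    ultimately show False using main \<eta>(3,4) by linarith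
  qed
  moreover have "real N \<ge> y / 2" using N y by linarith
  moreover have "y / 2 / 100 = 1 / (2000000 * \<epsilon>\<^sup>2)" by (simp add: y_def)
  ultimately show ?thesis by linarith
qed

theorem theorem1p2:
  fixes \<epsilon>\<^sub>0 :: real
  assumes "0 < \<epsilon>\<^sub>0" and "\<epsilon>\<^sub>0 < 1"
  shows "\<exists>c>0. \<exists>N::nat. \<forall>n\<ge>N. \<forall>\<epsilon>::real. \<forall>A q.
    0 < \<epsilon> \<and> \<epsilon> \<le> \<epsilon>\<^sub>0 \<and> 1 / \<epsilon>\<^sup>2 \<le> real n \<and>
    randomized_algorithm n A \<and> approximates_support_size n \<epsilon> A \<and> makes_at_most_queries n q A \<longrightarrow>
    real q \<ge> c * (ln (ln (ln (real n))) + 1 / (\<epsilon>\<^sup>2 * ln (1 / \<epsilon>)))"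
proof -
  \<comment> \<open>The first entry serves \<open>\<epsilon> \<le> 1 / 1000\<close>, where
    \<open>ln (1 / \<epsilon>) \<ge> 1\<close>. For larger \<epsilon>, which stay below
    \<open>\<epsilon>\<^sub>0 < 1\<close>, the second term of the bound is bounded, and
    \<open>q \<ge> 1\<close> suffices with the second entry.\<close>
  define c2 where "c2 = min (1 / 2000000) (ln (1 / \<epsilon>\<^sub>0) / 1000000)"
  \<comment> \<open>Each summand of the bound is charged to half of \<open>q\<close>; the triple
    logarithm is at most \<open>10 * q\<close>, whence \<open>1 / 20\<close>.\<close>
  define c where "c = min (1 / 20) (c2 / 2)"
  have ln0: "ln (1 / \<epsilon>\<^sub>0) > 0" using assms by simp
  have c2: "c2 > 0" using ln0 by (simp add: c2_def)
  have c: "c > 0" "c \<le> 1 / 20" "c \<le> c2 / 2" using c2 by (auto simp: c_def)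
  have "real q \<ge> c * (ln (ln (ln (real n))) + 1 / (\<epsilon>\<^sup>2 * ln (1 / \<epsilon>)))"
    if n: "n \<ge> 4 ^ 13" and \<epsilon>: "0 < \<epsilon>" "\<epsilon> \<le> \<epsilon>\<^sub>0" "1 / \<epsilon>\<^sup>2 \<le> real n"
      and alg: "randomized_algorithm n A" "approximates_support_size n \<epsilon> A" "makes_at_most_queries n q A"
    for n \<epsilon> A q
  proof -
    have \<epsilon>1: "\<epsilon> < 1" using \<epsilon> assms by simp
    have ln_\<epsilon>: "ln (1 / \<epsilon>\<^sub>0) \<le> ln (1 / \<epsilon>)" using \<epsilon> assms by (intro ln_mono) (auto simp: field_simps)
    have \<epsilon>2: "\<epsilon>\<^sup>2 > 0" using \<epsilon> by simp
    note lnln = ln_ln_ln_le[OF n queries_lower_bound_log[OF alg \<epsilon>(1) \<epsilon>1]]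
    have q: "q \<ge> 1" and "ln (ln (ln (real n))) \<le> 10 * real q" using lnln by blast+
    then have "c * ln (ln (ln (real n))) \<le> c * (10 * real q)" using c by (intro mult_left_mono) auto
    also have "\<dots> \<le> 1 / 20 * (10 * real q)" using c by (intro mult_right_mono) auto
    finally have 1: "c * ln (ln (ln (real n))) \<le> real q / 2" by simp
    let ?R = "1 / (\<epsilon>\<^sup>2 * ln (1 / \<epsilon>))"
    have R: "?R \<ge> 0" using \<epsilon>2 ln0 ln_\<epsilon> by simp
    have "c2 * ?R \<le> real q"
    proof (cases "\<epsilon> \<le> 1 / 1000")
      case True
      have "exp 1 \<le> 1 / \<epsilon>"
      proof -
        have "exp 1 \<le> (1000::real)" using exp_le by simp
        also have "\<dots> \<le> 1 / \<epsilon>" using True \<epsilon> by (simp add: field_simps)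
        finally show ?thesis .
      qed
      then have "1 \<le> ln (1 / \<epsilon>)" using \<epsilon> by (subst ln_ge_iff) auto
      then have "\<epsilon>\<^sup>2 * 1 \<le> \<epsilon>\<^sup>2 * ln (1 / \<epsilon>)" using \<epsilon>2 by (intro mult_left_mono) auto
      then have "?R \<le> 1 / \<epsilon>\<^sup>2" using \<epsilon>2 by (intro divide_left_mono) auto
      then have "c2 * ?R \<le> 1 / 2000000 * (1 / \<epsilon>\<^sup>2)"
        using R by (intro mult_mono) (auto simp: c2_def)
      also have "\<dots> \<le> real q" using queries_lower_bound_eps[OF alg \<epsilon>(1) True \<epsilon>(3)] by simp
      finally show ?thesis .
    next
      case False
      have "(1 / 1000)\<^sup>2 \<le> \<epsilon>\<^sup>2" using False by (intro power_mono) auto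
      then have "(1 / 1000000) * ln (1 / \<epsilon>\<^sub>0) \<le> \<epsilon>\<^sup>2 * ln (1 / \<epsilon>)"
        using ln_\<epsilon> ln0 by (intro mult_mono) (auto simp: power2_eq_square)
      moreover have "c2 \<le> (1 / 1000000) * ln (1 / \<epsilon>\<^sub>0)" by (simp add: c2_def)
      ultimately have "c2 \<le> \<epsilon>\<^sup>2 * ln (1 / \<epsilon>)" by linarith
      then have "c2 * ?R \<le> 1" using \<epsilon>2 ln0 ln_\<epsilon> by (simp add: field_simps)
      then show ?thesis using q by linarith
    qed
    moreover have "c * ?R \<le> c2 / 2 * ?R" using c R by (intro mult_right_mono) auto
    ultimately have "c * ?R \<le> real q / 2" by linarith
    then show ?thesis using 1 unfolding distrib_left by linarith
  qed
  then show ?thesis using c(1) by blast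
qed

end
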